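(* Let $G=(V,E)$ be a graph with $n$ vertices (possibly directed and with positive edge weights). Let $f$ and $L$ be positive integers, which may depend on $n$, such that $f=o(\log L)$. There exists a randomized $(L,f)$-replacement path covering for $G$ that with high probability has covering value $\widetilde{O}\big(fe^f(\frac{L}{f})^{f+o(1)}\big)$ and query time $\widetilde{O}\big(f^{5/2}e^f(\frac{L}{f})^{o(1)}\big)$, and the computed subfamily $\mathcal{G}_F$ has size $\widetilde{O}(fe^f)$. The same guarantees also hold for vertex failures, i.e. when the failure sets $F$ are sets of at most $f$ vertices. Moreover, for sensitivities up to $f=o(\log n)$, the covering value becomes $(\frac{L}{f})^f n^{o(1)}$ and the query time and the size of $\mathcal{G}_F$ become $n^{o(1)}$.
   Context: For a graph $G=(V,E)$ and a set $F$ of edges (resp. vertices), $G-F$ denotes $G$ with the elements of $F$ removed. An $(L,f)$-replacement path covering for $G$ is a family $\mathcal{G}$ of spanning subgraphs of $G$ together with, for every failure set $F$ with $|F|\le f$, a subfamily $\mathcal{G}_F\subseteq\mathcal{G}$ such that: (1) no subgraph in $\mathcal{G}_F$ contains an element of $F$; (2) for all $s,t\in V$ such that there exists a shortest path from $s$ to $t$ in $G-F$ with at most $L$ edges, at least one subgraph in $\mathcal{G}_F$ also contains such a path. The covering value is $|\mathcal{G}|$; the query time is the time needed to compute $\mathcal{G}_F$ from $F$. "With high probability" means with probability at least $1-n^{-c}$ for some constant $c>0$. $\widetilde{O}(g)$ means $O(g\cdot\mathrm{polylog}(n))$. *)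

theory Defs
  imports "HOL-Probability.Probability_Mass_Function" "HOL-Library.Landau_Symbols"
begin

section \<open>Graphs and shortest paths\<close>

text \<open>
  Graphs are simple, directed or undirected, with edge weights; unweighted graphs have
  constant weight 1. An undirected edge is stored once, as the pair with the smaller endpoint
  first, so that a failing undirected edge is a single element that blocks both directions.
\<close>

record graph =
  is_directed :: bool
  verts :: "nat set"
  edges :: "(nat \<times> nat) set"
  weight :: "nat \<times> nat \<Rightarrow> real"

definition wf_graph :: "graph \<Rightarrow> bool" where
  "wf_graph G \<longleftrightarrow> finite (verts G) \<and> edges G \<subseteq> verts G \<times> verts G \<and>
     (\<forall>(u, v) \<in> edges G. u \<noteq> v \<and> (\<not> is_directed G \<longrightarrow> u < v)) \<and>
     (\<forall>e \<in> edges G. weight G e > 0)"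

definition edge_between :: "graph \<Rightarrow> nat \<Rightarrow> nat \<Rightarrow> nat \<times> nat" where
  "edge_between G u v = (if is_directed G then (u, v) else (min u v, max u v))"

definition is_path :: "graph \<Rightarrow> nat \<Rightarrow> nat \<Rightarrow> nat list \<Rightarrow> bool" where
  "is_path G s t p \<longleftrightarrow> p \<noteq> [] \<and> hd p = s \<and> last p = t \<and> distinct p \<and> set p \<subseteq> verts G \<and>
     successively (\<lambda>u v. edge_between G u v \<in> edges G) p"

definition num_edges :: "nat list \<Rightarrow> nat" where
  "num_edges p = length p - 1"

definition path_weight :: "graph \<Rightarrow> nat list \<Rightarrow> real" where
  "path_weight G p = (\<Sum>i < num_edges p. weight G (edge_between G (p ! i) (p ! Suc i)))"

definition shortest_path :: "graph \<Rightarrow> nat \<Rightarrow> nat \<Rightarrow> nat list \<Rightarrow> bool" where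
  "shortest_path G s t p \<longleftrightarrow>
     is_path G s t p \<and> (\<forall>q. is_path G s t q \<longrightarrow> path_weight G p \<le> path_weight G q)"

definition subgraph :: "graph \<Rightarrow> graph \<Rightarrow> bool" where
  "subgraph H G \<longleftrightarrow> wf_graph H \<and> is_directed H = is_directed G \<and> weight H = weight G \<and>
     verts H \<subseteq> verts G \<and> edges H \<subseteq> edges G"

definition spanning_subgraph :: "graph \<Rightarrow> graph \<Rightarrow> bool" where
  "spanning_subgraph H G \<longleftrightarrow> subgraph H G \<and> verts H = verts G"


section \<open>Replacement path coverings\<close>

datatype failure_kind = Edge_Failures | Vertex_Failures

datatype elt = Edge nat nat | Vertex nat

fun contains :: "graph \<Rightarrow> elt \<Rightarrow> bool" where
  "contains G (Edge u v) \<longleftrightarrow> (u, v) \<in> edges G"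
| "contains G (Vertex v) \<longleftrightarrow> v \<in> verts G"

fun elements :: "failure_kind \<Rightarrow> graph \<Rightarrow> elt set" where
  "elements Edge_Failures G = {Edge u v | u v. (u, v) \<in> edges G}"
| "elements Vertex_Failures G = {Vertex v | v. v \<in> verts G}"

definition remove :: "graph \<Rightarrow> elt set \<Rightarrow> graph" where
  "remove G F = G\<lparr>
     verts := {v \<in> verts G. Vertex v \<notin> F},
     edges := {(u, v) \<in> edges G. Edge u v \<notin> F \<and> Vertex u \<notin> F \<and> Vertex v \<notin> F}\<rparr>"

text \<open>
  For vertex failures the members of the family cannot all be spanning, since those selected
  for \<open>F\<close> must not contain the vertices in \<open>F\<close>; there they are arbitrary subgraphs.
\<close>

definition replacement_path_covering ::
  "failure_kind \<Rightarrow> graph \<Rightarrow> nat \<Rightarrow> nat \<Rightarrow> graph set \<Rightarrow> (elt set \<Rightarrow> graph set) \<Rightarrow> bool" where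
  "replacement_path_covering k G L f \<G> sel \<longleftrightarrow>
     (\<forall>H \<in> \<G>. case k of Edge_Failures \<Rightarrow> spanning_subgraph H G
                     | Vertex_Failures \<Rightarrow> subgraph H G) \<and>
     (\<forall>F. F \<subseteq> elements k G \<and> card F \<le> f \<longrightarrow>
        sel F \<subseteq> \<G> \<and>
        (\<forall>H \<in> sel F. \<forall>x \<in> F. \<not> contains H x) \<and>
        (\<forall>s \<in> verts G. \<forall>t \<in> verts G.
           (\<exists>p. shortest_path (remove G F) s t p \<and> num_edges p \<le> L) \<longrightarrow>
           (\<exists>H \<in> sel F. \<exists>p. shortest_path (remove G F) s t p \<and> num_edges p \<le> L \<and>
                           is_path H s t p)))"


section \<open>Word RAM\<close>

text \<open>
  Query time is the number of steps of a structured word-RAM program. Words are natural numbers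
  below \<open>2 ^ w\<close> for a word size \<open>w\<close>. Besides registers and random-access memory, there is a
  read-only input array and an append-only output.
\<close>

datatype binop = Add | Sub | Mul | Div | Mod | And | Or | Xor | Shl | Shr | Less | Eq

fun alu :: "nat \<Rightarrow> binop \<Rightarrow> nat \<Rightarrow> nat \<Rightarrow> nat" where
  "alu w Add a b = (a + b) mod 2 ^ w"
| "alu w Sub a b = (a + 2 ^ w - b) mod 2 ^ w"
| "alu w Mul a b = (a * b) mod 2 ^ w"
| "alu w Div a b = a div b"
| "alu w Mod a b = a mod b"
| "alu w And a b = Bit_Operations.and a b"
| "alu w Or a b = Bit_Operations.or a b"
| "alu w Xor a b = Bit_Operations.xor a b"
| "alu w Shl a b = push_bit b a mod 2 ^ w"
| "alu w Shr a b = drop_bit b a"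
| "alu w Less a b = of_bool (a < b)"
| "alu w Eq a b = of_bool (a = b)"

type_synonym reg = nat

datatype com =
    Const reg nat
  | Op binop reg reg reg
  | Load reg reg
  | Store reg reg
  | Input reg reg
  | Output reg
  | Seq com com
  | If_nz reg com com
  | While_nz reg com

record state =
  regs :: "reg \<Rightarrow> nat"
  mem :: "nat \<Rightarrow> nat"
  out :: "nat list"

text \<open>Arrays are extended by zeros beyond their end.\<close>

definition cell :: "nat list \<Rightarrow> nat \<Rightarrow> nat" where
  "cell xs i = (if i < length xs then xs ! i else 0)"

text \<open>
  \<open>exec w inp c s t s'\<close>: with word size \<open>w\<close> and input \<open>inp\<close>, the program \<open>c\<close> started in \<open>s\<close>
  terminates after \<open>t\<close> steps in \<open>s'\<close>.
\<close>

inductive exec :: "nat \<Rightarrow> nat list \<Rightarrow> com \<Rightarrow> state \<Rightarrow> nat \<Rightarrow> state \<Rightarrow> bool"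
  for w :: nat and inp :: "nat list" where
  Const: "exec w inp (Const r a) s 1 (s\<lparr>regs := (regs s)(r := a mod 2 ^ w)\<rparr>)"
| Op: "exec w inp (Op b r x y) s 1
         (s\<lparr>regs := (regs s)(r := alu w b (regs s x) (regs s y))\<rparr>)"
| Load: "exec w inp (Load r x) s 1 (s\<lparr>regs := (regs s)(r := mem s (regs s x))\<rparr>)"
| Store: "exec w inp (Store x r) s 1 (s\<lparr>mem := (mem s)(regs s x := regs s r)\<rparr>)"
| Input: "exec w inp (Input r x) s 1 (s\<lparr>regs := (regs s)(r := cell inp (regs s x))\<rparr>)"
| Output: "exec w inp (Output r) s 1 (s\<lparr>out := out s @ [regs s r]\<rparr>)"
| Seq: "exec w inp c1 s t1 s1 \<Longrightarrow> exec w inp c2 s1 t2 s2 \<Longrightarrow>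
          exec w inp (Seq c1 c2) s (t1 + t2) s2"
| If_True: "regs s r \<noteq> 0 \<Longrightarrow> exec w inp c1 s t s' \<Longrightarrow> exec w inp (If_nz r c1 c2) s (t + 1) s'"
| If_False: "regs s r = 0 \<Longrightarrow> exec w inp c2 s t s' \<Longrightarrow> exec w inp (If_nz r c1 c2) s (t + 1) s'"
| While_False: "regs s r = 0 \<Longrightarrow> exec w inp (While_nz r c) s 1 s"
| While_True: "regs s r \<noteq> 0 \<Longrightarrow> exec w inp c s t1 s1 \<Longrightarrow>
                 exec w inp (While_nz r c) s1 t2 s2 \<Longrightarrow>
                 exec w inp (While_nz r c) s (t1 + t2 + 1) s2"

definition fits :: "nat \<Rightarrow> nat list \<Rightarrow> bool" where
  "fits w xs \<longleftrightarrow> length xs < 2 ^ w \<and> (\<forall>x \<in> set xs. x < 2 ^ w)"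

text \<open>Register 0 initially holds the length of the input.\<close>

definition init_state :: "nat list \<Rightarrow> nat list \<Rightarrow> state" where
  "init_state dat inp = \<lparr>regs = (\<lambda>_. 0)(0 := length inp), mem = cell dat, out = []\<rparr>"


section \<open>Coverings with a query algorithm\<close>

text \<open>
  The family is enumerated without repetition, and a member is named by its position. The
  preprocessed data structure \<open>data\<close> is the initial memory of the query algorithm.
\<close>

record covering =
  family :: "graph list"
  select :: "elt set \<Rightarrow> graph set"
  data :: "nat list"

fun encode :: "elt \<Rightarrow> nat list" where
  "encode (Edge u v) = [u, v]"
| "encode (Vertex v) = [v]"

definition covering_value :: "covering \<Rightarrow> nat" where
  "covering_value C = card (set (family C))"

definition is_covering :: "failure_kind \<Rightarrow> graph \<Rightarrow> nat \<Rightarrow> nat \<Rightarrow> covering \<Rightarrow> bool" where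
  "is_covering k G L f C \<longleftrightarrow> distinct (family C) \<and>
     replacement_path_covering k G L f (set (family C)) (select C)"

text \<open>
  On word size \<open>w\<close>, the program \<open>P\<close> computes the (names of the) selected subfamily in at most
  \<open>T\<close> steps, for every admissible failure set, listed in any order.
\<close>

definition query_time_le ::
  "failure_kind \<Rightarrow> graph \<Rightarrow> nat \<Rightarrow> com \<Rightarrow> nat \<Rightarrow> covering \<Rightarrow> nat \<Rightarrow> bool" where
  "query_time_le k G f P w C T \<longleftrightarrow> fits w (data C) \<and>
     (\<forall>xs. distinct xs \<and> set xs \<subseteq> elements k G \<and> length xs \<le> f \<longrightarrow>
        (let inp = concat (map encode xs) in
           fits w inp \<and>
           (\<exists>t s. exec w inp P (init_state (data C) inp) t s \<and> t \<le> T \<and>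
                  set (out s) \<subseteq> {..<length (family C)} \<and>
                  (\<lambda>i. family C ! i) ` set (out s) = select C (set xs))))"

definition selection_size_le :: "failure_kind \<Rightarrow> graph \<Rightarrow> nat \<Rightarrow> covering \<Rightarrow> nat \<Rightarrow> bool" where
  "selection_size_le k G f C S \<longleftrightarrow>
     (\<forall>F. F \<subseteq> elements k G \<and> card F \<le> f \<longrightarrow> card (select C F) \<le> S)"


section \<open>Asymptotic notation\<close>

definition soft_O :: "(nat \<Rightarrow> real) \<Rightarrow> (nat \<Rightarrow> nat) set" where
  "soft_O g = {h. \<exists>j::nat. (\<lambda>n. real (h n)) \<in> O(\<lambda>n. g n * ln (real n) ^ j)}"

text \<open>The bound \<open>g(n) n\<^bsup>o(1)\<^esup>\<close>.\<close>

definition up_to_subpoly :: "(nat \<Rightarrow> real) \<Rightarrow> (nat \<Rightarrow> nat) set" where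
  "up_to_subpoly g = {h. \<exists>\<delta> \<in> o(\<lambda>_. 1). \<forall>\<^sub>F n in sequentially. real (h n) \<le> g n * real n powr \<delta> n}"

end

theory Submission
  imports Defs
begin

text \<open>
  Hash the elements into \<open>m = L + 1 + f\<close> buckets. For a failure set \<open>F\<close> and a path \<open>p\<close> avoiding it,
  a random hash function separates the at most \<open>L + 1\<close> elements of \<open>p\<close> from \<open>F\<close> with probability at
  least \<open>((L + 1) / m)\<^bsup>L + 1\<^esup> \<ge> e\<^bsup>-f\<^esup>\<close>. Hence a greedy choice (the random choice, derandomised) of
  \<open>R = O(f e\<^bsup>f\<^esup> log n)\<close> hash functions contains a separating one for each of the at most \<open>n\<^bsup>3f + 2\<^esup>\<close>
  triples \<open>(F, s, t)\<close>. The family consists of the graphs obtained by removing, for one of these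
  functions \<open>h\<close>, all elements hashed into a set \<open>S\<close> of at most \<open>f\<close> buckets; the selection for \<open>F\<close>
  takes \<open>S = h(F)\<close> for each \<open>h\<close>. There are at most \<open>(e m / f)\<^bsup>f\<^esup>\<close> such \<open>S\<close>, which exceeds
  \<open>(L / f)\<^bsup>f\<^esup>\<close> by a factor \<open>e\<^bsup>O(f)\<^esup> = (L / f)\<^bsup>o(1)\<^esup>\<close>.

  For each \<open>h\<close>, a finite automaton with states \<open>S\<close> computes \<open>h(F)\<close> while reading \<open>F\<close>. All its
  transitions are tabulated in the preprocessed memory, whose size is polynomial in \<open>n\<close> and the
  covering value, so a query only follows pointers and takes \<open>O(R f)\<close> steps.

  The distribution over coverings is a point mass.
\<close>

section \<open>Separating hash functions\<close>

lemma card_subsets_card_le: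
  assumes "finite A"
  shows "card {S. S \<subseteq> A \<and> card S \<le> f} = (\<Sum>i\<le>f. card A choose i)"
proof -
  have "{S. S \<subseteq> A \<and> card S \<le> f} = (\<Union>i\<in>{..f}. {S. S \<subseteq> A \<and> card S = i})"
    by auto
  also have "card \<dots> = (\<Sum>i\<le>f. card {S. S \<subseteq> A \<and> card S = i})"
    using assms by (intro card_UN_disjoint) auto
  finally show ?thesis
    using assms by (simp add: n_subsets)
qed

text \<open>Weighting the terms by \<open>f choose i\<close>, which is at least 1, turns the sum
  into the binomial expansion of \<open>(N + 1) ^ f\<close>. This crude count is enough for failure
  sets, whose number affects \<open>R\<close> only through its logarithm.\<close>

lemma sum_choose_le_power: "(\<Sum>i\<le>f. N choose i) \<le> (N + 1) ^ f"
proof -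
  have "(\<Sum>i\<le>f. N choose i) \<le> (\<Sum>i\<le>f. (f choose i) * N ^ i)"
  proof (rule sum_mono)
    fix i assume "i \<in> {..f}"
    then have "1 \<le> f choose i" by (simp add: Suc_leI)
    moreover have "N choose i \<le> N ^ i"
      by (cases "i \<le> N") (auto intro: binomial_le_pow simp: binomial_eq_0)
    ultimately show "N choose i \<le> (f choose i) * N ^ i"
      by (metis mult_le_mono nat_mult_1)
  qed
  also have "\<dots> = (N + 1) ^ f"
    using binomial_ring[of N 1 f] by simp
  finally show ?thesis .
qed

text \<open>With \<open>q = f / m \<le> 1\<close>, the sum times \<open>q ^ f\<close> is at most the
  sum of the terms times \<open>q ^ i\<close>. Extended to all \<open>i \<le> m\<close>, the latter
  is \<open>(1 + q) ^ m \<le> exp (q * m) = exp f\<close>. Bucket sets need this sharper count,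
  since their number is a factor of the covering value.\<close>

lemma sum_choose_le_exp:
  assumes "1 \<le> f" "f \<le> m"
  shows "real (\<Sum>i\<le>f. m choose i) \<le> (real m / real f) ^ f * exp (real f)"
proof -
  define q where "q = real f / real m"
  have q: "0 < q" "q \<le> 1" using assms by (auto simp: q_def)
  have "real (\<Sum>i\<le>f. m choose i) * q ^ f = (\<Sum>i\<le>f. real (m choose i) * q ^ f)"
    by (simp add: sum_distrib_right)
  also have "\<dots> \<le> (\<Sum>i\<le>f. real (m choose i) * q ^ i)"
    using q by (intro sum_mono mult_left_mono power_decreasing) auto
  also have "\<dots> \<le> (\<Sum>i\<le>m. real (m choose i) * q ^ i)"
    using q assms by (intro sum_mono2) auto
  also have "\<dots> = (1 + q) ^ m"
    using binomial_ring[of q 1 m] by (simp add: add.commute)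
  also have "\<dots> \<le> exp q ^ m"
    using q by (intro power_mono) auto
  also have "\<dots> = exp (real f)"
    using assms by (simp add: q_def flip: exp_of_nat_mult)
  finally have "real (\<Sum>i\<le>f. m choose i) \<le> exp (real f) / q ^ f"
    using q by (simp add: pos_le_divide_eq)
  then show ?thesis
    by (simp add: q_def power_divide field_simps)
qed

text \<open>Values on \<open>F\<close> are chosen freely and occupy at most \<open>f\<close> of the
  \<open>l + f\<close> buckets, so each element of \<open>Q\<close> keeps at least \<open>l\<close>
  choices; all other elements are free. The surviving fraction is at least
  \<open>(l / (l + f)) ^ card Q\<close>, which is at least \<open>exp (- f)\<close> by
  \<open>1 + x \<le> exp x\<close> and \<open>card Q \<le> l\<close>.\<close>

lemma card_separating_hashes:
  fixes f l :: nat
  assumes "finite U" "F \<subseteq> U" "Q \<subseteq> U" "F \<inter> Q = {}" "card F \<le> f" "card Q \<le> l" "1 \<le> l"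
  defines "M \<equiv> {..<l + f}"
  shows "exp (- real f) * real (card (U \<rightarrow>\<^sub>E M))
           \<le> real (card {h \<in> U \<rightarrow>\<^sub>E M. h ` Q \<inter> h ` F = {}})"
proof -
  have fin: "finite F" "finite Q" "finite M"
    using assms finite_subset by auto
  define m where "m = l + f"
  have m: "card M = m" "m \<ge> 1" using assms by (auto simp: M_def m_def)
  \<comment> \<open>\<open>T g x\<close> holds the buckets still allowed at \<open>x\<close> once
    \<open>g\<close> fixes the values on \<open>F\<close>. \<open>D\<close> pairs \<open>g\<close>
    with such an extension, and \<open>\<phi>\<close> glues the two.\<close>
  define T where "T = (\<lambda>g x. if x \<in> Q then M - g ` F else M)"
  define D where "D = (SIGMA g : F \<rightarrow>\<^sub>E M. Pi\<^sub>E (U - F) (T g))"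
  define \<phi> where "\<phi> = (\<lambda>(g :: 'a \<Rightarrow> nat, g') x. if x \<in> F then g x else g' x)"
  define A where "A = {h \<in> U \<rightarrow>\<^sub>E M. h ` Q \<inter> h ` F = {}}"
  have finA: "finite A"
    unfolding A_def using fin assms by (intro finite_subset[OF _ finite_PiE[of U "\<lambda>_. M"]]) auto
  have T: "T g x \<subseteq> M" "finite (T g x)" for g x
    using fin by (auto simp: T_def)
  \<comment> \<open>Extensional functions are \<open>undefined\<close> off their domain, so the
    glued function determines both parts.\<close>
  have "inj_on \<phi> D"
  proof (rule inj_onI)
    fix a b assume ab: "a \<in> D" "b \<in> D" "\<phi> a = \<phi> b"
    obtain g g' k k' where [simp]: "a = (g, g')" "b = (k, k')" by fastforce
    have mem: "g \<in> F \<rightarrow>\<^sub>E M" "k \<in> F \<rightarrow>\<^sub>E M" "g' \<in> Pi\<^sub>E (U - F) (T g)" "k' \<in> Pi\<^sub>E (U - F) (T k)"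
      using ab by (auto simp: D_def)
    have eq: "(if x \<in> F then g x else g' x) = (if x \<in> F then k x else k' x)" for x
      using fun_cong[OF ab(3), of x] by (simp add: \<phi>_def)
    have "g x = k x" for x
      using eq[of x] mem by (cases "x \<in> F") (auto simp: PiE_arb[OF mem(1)] PiE_arb[OF mem(2)])
    moreover have "g' x = k' x" for x
      using eq[of x] mem by (cases "x \<in> F") (auto simp: PiE_arb[OF mem(3)] PiE_arb[OF mem(4)])
    ultimately show "a = b" by auto
  qed
  moreover have "\<phi> ` D \<subseteq> A"
  proof
    fix h assume "h \<in> \<phi> ` D"
    then obtain g g' where h: "h = \<phi> (g, g')" "g \<in> F \<rightarrow>\<^sub>E M" "g' \<in> Pi\<^sub>E (U - F) (T g)"
      by (auto simp: D_def)
    have hx: "h x = (if x \<in> F then g x else g' x)" for x by (simp add: h \<phi>_def)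
    have 1: "h x \<in> M" if "x \<in> U" for x
      using that h(2,3) subsetD[OF T(1), of "g' x" g x] by (cases "x \<in> F") (auto simp: hx PiE_iff)
    have 2: "h x = undefined" if "x \<notin> U" for x
      using that h(2,3) assms(2) by (auto simp: hx)
    have 3: "h x \<noteq> h y" if "x \<in> Q" "y \<in> F" for x y
    proof -
      have "x \<notin> F" "x \<in> U - F" using that assms by auto
      then have "g' x \<in> M - g ` F" using PiE_mem[OF h(3), of x] that by (simp add: T_def)
      then show ?thesis using \<open>x \<notin> F\<close> that by (auto simp: hx)
    qed
    show "h \<in> A" unfolding A_def using 1 2 3 by (auto simp: PiE_iff extensional_def)
  qed
  ultimately have DA: "card D \<le> card A"
    using finA by (metis card_inj_on_le)
  have "real m ^ card F * (real l ^ card Q * real m ^ card (U - F - Q)) \<le> real (card D)"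
  proof -
    have "card D = (\<Sum>g\<in>F \<rightarrow>\<^sub>E M. card (Pi\<^sub>E (U - F) (T g)))"
      unfolding D_def using fin assms T by (intro card_SigmaI) (auto intro!: finite_PiE)
    also have "\<dots> \<ge> (\<Sum>g\<in>F \<rightarrow>\<^sub>E M. l ^ card Q * m ^ card (U - F - Q))"
    proof (rule sum_mono)
      fix g assume "g \<in> F \<rightarrow>\<^sub>E M"
      have "card (g ` F) \<le> f" using fin assms card_image_le order_trans by blast
      then have "l \<le> card (M - g ` F)"
        using diff_card_le_card_Diff[of "g ` F" M] fin m by (simp add: m_def)
      then have "l ^ card Q * m ^ card (U - F - Q) \<le> card (M - g ` F) ^ card Q * m ^ card (U - F - Q)"
        by (simp add: power_mono)
      also have "\<dots> = (\<Prod>x\<in>Q. card (T g x)) * (\<Prod>x\<in>U - F - Q. card (T g x))"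
        using m by (simp add: T_def)
      also have "\<dots> = (\<Prod>x\<in>U - F. card (T g x))"
        using assms by (subst prod.union_disjoint[symmetric]) (auto intro!: prod.cong finite_subset[of Q U])
      also have "\<dots> = card (Pi\<^sub>E (U - F) (T g))"
        using assms by (simp add: card_PiE)
      finally show "l ^ card Q * m ^ card (U - F - Q) \<le> card (Pi\<^sub>E (U - F) (T g))" .
    qed
    finally have "m ^ card F * (l ^ card Q * m ^ card (U - F - Q)) \<le> card D"
      using fin m by (simp add: card_PiE)
    then have "real (m ^ card F * (l ^ card Q * m ^ card (U - F - Q))) \<le> real (card D)"
      by (rule of_nat_mono)
    then show ?thesis by simp
  qed
  moreover have "exp (- real f) * real (card (U \<rightarrow>\<^sub>E M))
      \<le> real m ^ card F * (real l ^ card Q * real m ^ card (U - F - Q))"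
  proof -
    have cU: "card U = card F + (card Q + card (U - F - Q))"
    proof -
      have "card U = card (F \<union> (Q \<union> (U - F - Q)))"
        using assms by (intro arg_cong[of _ _ card]) auto
      also have "\<dots> = card F + card (Q \<union> (U - F - Q))"
        using assms fin by (intro card_Un_disjoint) auto
      also have "card (Q \<union> (U - F - Q)) = card Q + card (U - F - Q)"
        using assms fin by (intro card_Un_disjoint) auto
      finally show ?thesis .
    qed
    have "exp (- real f) * real m ^ card Q \<le> real l ^ card Q"
    proof -
      have "real m / real l \<le> exp (real f / real l)"
        using assms(7) exp_ge_add_one_self[of "real f / real l"]
        by (simp add: m_def add_divide_distrib)
      then have "(real m / real l) ^ card Q \<le> exp (real f / real l) ^ card Q"
        by (intro power_mono) auto
      also have "\<dots> \<le> exp (real f / real l) ^ l"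
        using assms by (intro power_increasing) auto
      also have "\<dots> = exp (real f)"
        using assms(7) by (simp flip: exp_of_nat_mult)
      finally have "real m ^ card Q \<le> exp (real f) * real l ^ card Q"
        using assms(7) by (simp add: power_divide field_simps)
      then show ?thesis by (simp add: exp_minus field_simps)
    qed
    then have "exp (- real f) * real m ^ card Q * (real m ^ card F * real m ^ card (U - F - Q))
        \<le> real l ^ card Q * (real m ^ card F * real m ^ card (U - F - Q))"
      by (intro mult_right_mono) auto
    then show ?thesis
      using assms(1) m by (simp add: card_PiE cU power_add mult_ac)
  qed
  ultimately show ?thesis using DA unfolding A_def by linarith
qed

section \<open>Averaging and greedy selection\<close>

lemma exists_above_average:
  fixes p :: real
  assumes "finite H" "H \<noteq> {}" "finite X"
    and dense: "\<And>x. x \<in> X \<Longrightarrow> p * real (card H) \<le> real (card {h \<in> H. good h x})"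
  shows "\<exists>h \<in> H. p * real (card X) \<le> real (card {x \<in> X. good h x})"
proof (rule ccontr)
  assume "\<not> ?thesis"
  then have "(\<Sum>h\<in>H. real (card {x \<in> X. good h x})) < (\<Sum>h\<in>H. p * real (card X))"
    using assms by (intro sum_strict_mono) auto
  also have "\<dots> = (\<Sum>x\<in>X. p * real (card H))" by simp
  also have "\<dots> \<le> (\<Sum>x\<in>X. real (card {h \<in> H. good h x}))"
    using dense by (intro sum_mono) auto
  \<comment> \<open>Double counting of the pairs \<open>(h, x)\<close> with
    \<open>good h x\<close>.\<close>
  also have "\<dots> = (\<Sum>h\<in>H. real (card {x \<in> X. good h x}))"
    using sum_multicount_gen[OF \<open>finite H\<close> \<open>finite X\<close>, of good "\<lambda>x. card {h \<in> H. good h x}"]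
    by (simp flip: of_nat_sum)
  finally show False by simp
qed

text \<open>Density is assumed for each \<open>x\<close> separately, so averaging applies afresh to
  the set of elements still uncovered: some \<open>h\<close> handles a fraction \<open>p\<close> of
  it, and each choice shrinks it by a factor \<open>1 - p\<close>. This replaces drawing
  \<open>R\<close> random hash functions.\<close>

lemma greedy_cover:
  fixes p :: real
  assumes "finite H" "H \<noteq> {}" "finite X" "p \<le> 1"
    and dense: "\<And>x. x \<in> X \<Longrightarrow> p * real (card H) \<le> real (card {h \<in> H. good h x})"
  shows "\<exists>hs. length hs = R \<and> set hs \<subseteq> H \<and>
           real (card {x \<in> X. \<forall>h \<in> set hs. \<not> good h x}) \<le> (1 - p) ^ R * real (card X)"
proof (induction R)
  case 0
  then show ?case by simp
next
  case (Suc R)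
  then obtain hs where hs: "length hs = R" "set hs \<subseteq> H"
    "real (card {x \<in> X. \<forall>h \<in> set hs. \<not> good h x}) \<le> (1 - p) ^ R * real (card X)"
    by blast
  define Y where "Y = {x \<in> X. \<forall>h \<in> set hs. \<not> good h x}"
  have "finite Y" using assms by (simp add: Y_def)
  then obtain h where h: "h \<in> H" "p * real (card Y) \<le> real (card {x \<in> Y. good h x})"
    using exists_above_average[of H Y p good] assms by (auto simp: Y_def)
  have "{x \<in> X. \<forall>h' \<in> set (h # hs). \<not> good h' x} = Y - {x \<in> Y. good h x}"
    by (auto simp: Y_def)
  then have "real (card {x \<in> X. \<forall>h' \<in> set (h # hs). \<not> good h' x})
      = real (card Y) - real (card {x \<in> Y. good h x})"
    using \<open>finite Y\<close> by (simp add: card_Diff_subset of_nat_diff card_mono)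
  also have "\<dots> \<le> (1 - p) * real (card Y)"
    using h(2) by (simp add: algebra_simps)
  also have "\<dots> \<le> (1 - p) * ((1 - p) ^ R * real (card X))"
    using hs(3) \<open>p \<le> 1\<close> by (intro mult_left_mono) (auto simp: Y_def)
  finally show ?case
    using hs h(1) by (intro exI[of _ "h # hs"]) (simp add: mult.assoc)
qed

section \<open>Paths under failures\<close>

lemma remove_simps [simp]:
  "is_directed (remove G F) = is_directed G" "weight (remove G F) = weight G"
  "verts (remove G F) = {v \<in> verts G. Vertex v \<notin> F}"
  "(u, v) \<in> edges (remove G F) \<longleftrightarrow>
     (u, v) \<in> edges G \<and> Edge u v \<notin> F \<and> Vertex u \<notin> F \<and> Vertex v \<notin> F"
  by (auto simp: remove_def)

lemma edge_between_remove [simp]: "edge_between (remove G F) u v = edge_between G u v"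
  by (simp add: edge_between_def)

lemma subgraph_remove:
  assumes "wf_graph G"
  shows "subgraph (remove G F) G"
  using assms unfolding subgraph_def wf_graph_def by (auto simp: remove_def)

lemma not_contains_remove: "x \<in> F \<Longrightarrow> \<not> contains (remove G F) x"
  by (cases x) auto

text \<open>Intersecting with \<open>elements k G\<close> keeps only the edges of the path under
  edge failures and only its vertices under vertex failures. One definition thus serves both kinds,
  and \<open>L + 1\<close> bounds the number of elements in either case.\<close>

definition path_elements :: "failure_kind \<Rightarrow> graph \<Rightarrow> nat list \<Rightarrow> elt set" where
  "path_elements k G p = elements k G \<inter>
     (Vertex ` set p \<union> {case_prod Edge (edge_between G (p ! i) (p ! Suc i)) | i. Suc i < length p})"

lemma card_path_elements_le:
  assumes "num_edges p \<le> L"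
  shows "card (path_elements k G p) \<le> L + 1"
proof (cases k)
  case Edge_Failures
  let ?e = "\<lambda>i. case_prod Edge (edge_between G (p ! i) (p ! Suc i))"
  have "path_elements k G p \<subseteq> ?e ` {..<num_edges p}"
    using Edge_Failures by (auto simp: path_elements_def num_edges_def)
  then have "card (path_elements k G p) \<le> card {..<num_edges p}"
    by (meson card_image_le card_mono finite_imageI finite_lessThan le_trans)
  then show ?thesis using assms by simp
next
  case Vertex_Failures
  have "x \<in> Vertex ` set p" if "x \<in> path_elements k G p" for x
    using that Vertex_Failures by (cases x) (auto simp: path_elements_def split: prod.splits)
  then have "path_elements k G p \<subseteq> Vertex ` set p" by blast
  then have "card (path_elements k G p) \<le> card (set p)"
    by (meson card_image_le card_mono finite_imageI finite_set le_trans)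
  also have "\<dots> \<le> length p" by (rule card_length)
  finally show ?thesis using assms by (simp add: num_edges_def)
qed

lemma path_elements_disjoint:
  assumes "is_path (remove G F) s t p"
  shows "F \<inter> path_elements k G p = {}"
proof -
  have "x \<notin> F" if x: "x \<in> path_elements k G p" for x
  proof -
    consider (v) v where "v \<in> set p" "x = Vertex v"
      | (e) i where "Suc i < length p" "x = case_prod Edge (edge_between G (p ! i) (p ! Suc i))"
      using x by (auto simp: path_elements_def)
    then show ?thesis
    proof cases
      case v
      then show ?thesis using assms by (auto simp: is_path_def)
    next
      case e
      have "edge_between G (p ! i) (p ! Suc i) \<in> edges (remove G F)"
        using assms e(1) by (auto simp: is_path_def successively_conv_nth)
      then show ?thesis using e(2) by (cases "edge_between G (p ! i) (p ! Suc i)") auto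
    qed
  qed
  then show ?thesis by blast
qed

text \<open>Whether \<open>p\<close> survives a deletion depends only on its own elements. In the
  application \<open>F'\<close> consists of all elements colliding with \<open>F\<close> under a
  hash function: a path shortest after deleting \<open>F\<close> is still present after deleting the
  larger \<open>F'\<close>. The inclusion \<open>F' \<subseteq> elements k G\<close> ensures that
  \<open>path_elements\<close> sees every element of \<open>F'\<close> on the path.\<close>

lemma is_path_remove_transfer:
  assumes "is_path (remove G F) s t p" "F' \<subseteq> elements k G" "F' \<inter> path_elements k G p = {}"
  shows "is_path (remove G F') s t p"
proof -
  have v: "Vertex v \<notin> F'" if "v \<in> set p" for v
    using assms that by (auto simp: path_elements_def)
  have "edge_between G (p ! i) (p ! Suc i) \<in> edges (remove G F')" if i: "Suc i < length p" for i
  proof -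
    obtain a b where ab: "edge_between G (p ! i) (p ! Suc i) = (a, b)" by fastforce
    have "(a, b) \<in> edges (remove G F)"
      using assms(1) i ab by (auto simp: is_path_def successively_conv_nth)
    moreover have "Edge a b \<notin> F'"
    proof
      assume E: "Edge a b \<in> F'"
      then have "Edge a b \<in> path_elements k G p"
        using assms(2) i ab by (force simp: path_elements_def)
      then show False using E assms(3) by blast
    qed
    \<comment> \<open>\<open>remove\<close> also deletes the edges at a deleted vertex, so both
      endpoints, possibly swapped by \<open>edge_between\<close>, must be traced back to
      \<open>p\<close>.\<close>
    moreover have "{a, b} \<subseteq> set p"
      using ab i by (auto simp: edge_between_def min_def max_def split: if_splits)
    ultimately show ?thesis using v ab by simp
  qed
  then show ?thesis
    using assms(1) v by (auto simp: is_path_def successively_conv_nth)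
qed

section \<open>Sizes of element sets and encoded queries\<close>

lemma elements_bound:
  assumes "wf_graph G" "verts G = {..<n}"
  shows "finite (elements k G)" "card (elements k G) \<le> n\<^sup>2"
proof -
  have "finite (elements k G) \<and> card (elements k G) \<le> n\<^sup>2"
  proof (cases k)
    case Edge_Failures
    have "elements k G \<subseteq> case_prod Edge ` ({..<n} \<times> {..<n})"
      using assms Edge_Failures by (force simp: wf_graph_def)
    moreover have "card (case_prod Edge ` ({..<n} \<times> {..<n})) \<le> n\<^sup>2"
      using card_image_le[of "{..<n} \<times> {..<n}" "case_prod Edge"] by (simp add: power2_eq_square)
    ultimately show ?thesis
      by (meson card_mono finite_SigmaI finite_imageI finite_lessThan finite_subset le_trans)
  next
    case Vertex_Failures
    have "elements k G \<subseteq> Vertex ` {..<n}"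
      using assms Vertex_Failures by auto
    moreover have "card (Vertex ` {..<n}) \<le> n\<^sup>2"
      using card_image_le[of "{..<n}" Vertex] by (auto simp: power2_eq_square intro: order_trans)
    ultimately show ?thesis
      by (meson card_mono finite_imageI finite_lessThan finite_subset le_trans)
  qed
  then show "finite (elements k G)" "card (elements k G) \<le> n\<^sup>2" by auto
qed

lemma encode_bounds:
  assumes "wf_graph G" "verts G = {..<n}" "set xs \<subseteq> elements k G"
  shows "set (concat (map encode xs)) \<subseteq> {..<n}" "length (concat (map encode xs)) \<le> 2 * length xs"
proof -
  have "set (encode x) \<subseteq> {..<n}" if "x \<in> elements k G" for x
    using that assms by (cases k) (force simp: wf_graph_def)+
  then show "set (concat (map encode xs)) \<subseteq> {..<n}"
    using assms(3) by force
  have "length (encode x) \<le> 2" for x by (cases x) auto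
  from add_mono[OF this] show "length (concat (map encode xs)) \<le> 2 * length xs"
    by (induction xs) auto
qed

section \<open>Tabulated automata on the word RAM\<close>

text \<open>
  Registers: 0 input length, 1 the constant 1, 2 the constant 0, 3 index of the automaton,
  4 address of the current state, 5 number of unread symbols, 6 current symbol. The input is
  consumed from its end, so that a run is a \<open>foldr\<close>.
\<close>

definition read_symbol :: com where
  "read_symbol = Seq (Op Sub 5 5 1) (Seq (Input 6 5) (Seq (Op Add 4 4 6) (Load 4 4)))"

definition run_automaton :: com where
  "run_automaton = Seq (Load 4 3) (Seq (Op Add 5 0 2) (Seq (While_nz 5 read_symbol)
     (Seq (Op Sub 4 4 1) (Seq (Load 4 4) (Seq (Output 4) (Op Sub 3 3 1))))))"

definition run_automata :: com where
  "run_automata = Seq (Const 1 1) (Seq (Load 3 2) (While_nz 3 run_automaton))"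

lemma alu_Sub_one:
  assumes "0 < a" "a < 2 ^ w"
  shows "alu w Sub a (Suc 0) = a - 1"
proof -
  have shift: "a + 2 ^ w - Suc 0 = (a - 1) + 2 ^ w" using assms by simp
  have "alu w Sub a (Suc 0) = ((a - 1) + 2 ^ w) mod 2 ^ w"
    unfolding alu.simps shift ..
  also have "\<dots> = a - 1" using assms by (subst mod_add_self2) simp
  finally show ?thesis .
qed

text \<open>
  A state \<open>q\<close> is represented by an address \<open>base q\<close>: its result is stored just below, its successor
  under the symbol \<open>a\<close> at offset \<open>a\<close>. Cells \<open>1, \<dots>, R\<close> hold the start states of the \<open>R\<close> automata.
\<close>

locale automaton_memory =
  fixes w n R :: nat and Q :: "'q set" and step :: "nat \<Rightarrow> 'q \<Rightarrow> 'q"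
    and result :: "'q \<Rightarrow> nat" and start :: "nat \<Rightarrow> 'q"
    and base :: "'q \<Rightarrow> nat" and memory :: "nat \<Rightarrow> nat"
  assumes step_closed: "q \<in> Q \<Longrightarrow> a < n \<Longrightarrow> step a q \<in> Q"
    and start_closed: "1 \<le> i \<Longrightarrow> i \<le> R \<Longrightarrow> start i \<in> Q"
    and memory_0: "memory 0 = R"
    and memory_start: "1 \<le> i \<Longrightarrow> i \<le> R \<Longrightarrow> memory i = base (start i)"
    and memory_step: "q \<in> Q \<Longrightarrow> a < n \<Longrightarrow> memory (base q + a) = base (step a q)"
    and memory_result: "q \<in> Q \<Longrightarrow> memory (base q - 1) = result q"
    and base_pos: "q \<in> Q \<Longrightarrow> 0 < base q"
    and base_word: "q \<in> Q \<Longrightarrow> base q + n < 2 ^ w"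
    and R_word: "R < 2 ^ w"
begin

lemma foldr_closed: "q \<in> Q \<Longrightarrow> set inp \<subseteq> {..<n} \<Longrightarrow> foldr step inp q \<in> Q"
  by (induction inp) (auto intro: step_closed)

text \<open>An iteration costs four instructions and one loop test. It consumes the last of the
  first \<open>j\<close> symbols, which is the innermost application in \<open>foldr\<close>; hence
  the induction generalises over \<open>q\<close>.\<close>

lemma exec_read_symbols:
  assumes "set inp \<subseteq> {..<n}" "length inp < 2 ^ w" "j \<le> length inp"
    and "regs s 5 = j" "regs s 1 = 1" "regs s 4 = base q" "q \<in> Q" "mem s = memory"
  shows "\<exists>s'. exec w inp (While_nz 5 read_symbol) s (5 * j + 1) s' \<and>
           regs s' 4 = base (foldr step (take j inp) q) \<and>
           (\<forall>r \<in> {0, 1, 2, 3}. regs s' r = regs s r) \<and> mem s' = memory \<and> out s' = out s"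
  using assms(3-)
proof (induction j arbitrary: s q)
  case 0
  then show ?case
    using exec.While_False[of s 5 w inp read_symbol] by auto
next
  case (Suc j)
  define a where "a = inp ! j"
  have a: "a < n" "cell inp j = a"
    using Suc.prems(1) assms(1) nth_mem[of j inp] by (auto simp: a_def cell_def simp del: nth_mem)
  define s1 where "s1 = s\<lparr>regs := (regs s)(5 := j, 6 := a, 4 := base (step a q))\<rparr>"
  have sub: "alu w Sub (Suc j) (Suc 0) = j"
    using alu_Sub_one[of "Suc j" w] Suc.prems(1) assms(2) by simp
  have add: "alu w Add (base q) a = base q + a"
    using base_word[OF Suc.prems(5)] a by simp
  have 1: "exec w inp (Op Sub 5 5 1) s 1 (s\<lparr>regs := (regs s)(5 := j)\<rparr>)"
    using exec.Op[of w inp Sub 5 5 1 s] sub Suc.prems by (simp del: alu.simps)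
  have 2: "exec w inp (Input 6 5) (s\<lparr>regs := (regs s)(5 := j)\<rparr>) 1
      (s\<lparr>regs := (regs s)(5 := j, 6 := a)\<rparr>)"
    using exec.Input[of w inp 6 5 "s\<lparr>regs := (regs s)(5 := j)\<rparr>"] a by simp
  have 3: "exec w inp (Op Add 4 4 6) (s\<lparr>regs := (regs s)(5 := j, 6 := a)\<rparr>) 1
      (s\<lparr>regs := (regs s)(5 := j, 6 := a, 4 := base q + a)\<rparr>)"
    using exec.Op[of w inp Add 4 4 6 "s\<lparr>regs := (regs s)(5 := j, 6 := a)\<rparr>"] add Suc.prems
    by (simp del: alu.simps)
  have 4: "exec w inp (Load 4 4) (s\<lparr>regs := (regs s)(5 := j, 6 := a, 4 := base q + a)\<rparr>) 1 s1"
    using exec.Load[of w inp 4 4 "s\<lparr>regs := (regs s)(5 := j, 6 := a, 4 := base q + a)\<rparr>"]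
      memory_step[OF Suc.prems(5) a(1)] Suc.prems by (simp add: s1_def)
  have "exec w inp read_symbol s (1 + (1 + (1 + 1))) s1"
    unfolding read_symbol_def by (intro exec.Seq[OF 1] exec.Seq[OF 2] exec.Seq[OF 3] 4)
  then have body: "exec w inp read_symbol s 4 s1" by (simp add: eval_nat_numeral)
  obtain s2 where s2: "exec w inp (While_nz 5 read_symbol) s1 (5 * j + 1) s2"
    "regs s2 4 = base (foldr step (take j inp) (step a q))"
    "\<forall>r \<in> {0, 1, 2, 3}. regs s2 r = regs s1 r" "mem s2 = memory" "out s2 = out s1"
    using Suc.IH[of s1 "step a q"] Suc.prems step_closed[OF Suc.prems(5) a(1)]
    by (auto simp: s1_def)
  have "exec w inp (While_nz 5 read_symbol) s (4 + (5 * j + 1) + 1) s2"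
    using exec.While_True[OF _ body s2(1)] Suc.prems by simp
  moreover have "4 + (5 * j + 1) + 1 = 5 * Suc j + 1" by simp
  moreover have "foldr step (take (Suc j) inp) q = foldr step (take j inp) (step a q)"
    using Suc.prems(1) by (simp add: take_Suc_conv_app_nth a_def)
  ultimately show ?case
    using s2 by (intro exI[of _ s2]) (auto simp: s1_def)
qed

lemma exec_run_automaton:
  assumes "set inp \<subseteq> {..<n}" "length inp < 2 ^ w"
    and "regs s 0 = length inp" "regs s 1 = 1" "regs s 2 = 0" "regs s 3 = i" "mem s = memory"
    and "1 \<le> i" "i \<le> R"
  shows "\<exists>s'. exec w inp run_automaton s (5 * length inp + 7) s' \<and>
           regs s' 0 = length inp \<and> regs s' 1 = 1 \<and> regs s' 2 = 0 \<and> regs s' 3 = i - 1 \<and>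
           mem s' = memory \<and> out s' = out s @ [result (foldr step inp (start i))]"
proof -
  define s1 where "s1 = s\<lparr>regs := (regs s)(4 := base (start i), 5 := length inp)\<rparr>"
  have 1: "exec w inp (Load 4 3) s 1 (s\<lparr>regs := (regs s)(4 := base (start i))\<rparr>)"
    using exec.Load[of w inp 4 3 s] assms memory_start[of i] by simp
  have 2: "exec w inp (Op Add 5 0 2) (s\<lparr>regs := (regs s)(4 := base (start i))\<rparr>) 1 s1"
    using exec.Op[of w inp Add 5 0 2 "s\<lparr>regs := (regs s)(4 := base (start i))\<rparr>"] assms
    by (simp add: s1_def)
  define q where "q = foldr step inp (start i)"
  have q: "q \<in> Q" using foldr_closed start_closed assms by (simp add: q_def)
  obtain s2 where s2: "exec w inp (While_nz 5 read_symbol) s1 (5 * length inp + 1) s2"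
    "regs s2 4 = base q" "\<forall>r \<in> {0, 1, 2, 3}. regs s2 r = regs s1 r"
    "mem s2 = memory" "out s2 = out s1"
    using exec_read_symbols[OF assms(1,2), of "length inp" s1 "start i"] assms start_closed[of i]
    by (auto simp: s1_def q_def)
  have regs2: "regs s2 0 = length inp" "regs s2 1 = 1" "regs s2 2 = 0" "regs s2 3 = i"
    using s2(3) assms by (auto simp: s1_def)
  have sub4: "alu w Sub (base q) (Suc 0) = base q - 1"
    using alu_Sub_one[of "base q" w] base_pos[OF q] base_word[OF q] by linarith
  have sub3: "alu w Sub i (Suc 0) = i - 1"
    using alu_Sub_one[of i w] assms R_word by linarith
  have 3: "exec w inp (Op Sub 4 4 1) s2 1 (s2\<lparr>regs := (regs s2)(4 := base q - 1)\<rparr>)"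
    using exec.Op[of w inp Sub 4 4 1 s2] sub4 s2 regs2 by (simp del: alu.simps)
  have 4: "exec w inp (Load 4 4) (s2\<lparr>regs := (regs s2)(4 := base q - 1)\<rparr>) 1
      (s2\<lparr>regs := (regs s2)(4 := result q)\<rparr>)"
    using exec.Load[of w inp 4 4 "s2\<lparr>regs := (regs s2)(4 := base q - 1)\<rparr>"] memory_result[OF q] s2
    by simp
  have 5: "exec w inp (Output 4) (s2\<lparr>regs := (regs s2)(4 := result q)\<rparr>) 1
      (s2\<lparr>regs := (regs s2)(4 := result q), out := out s2 @ [result q]\<rparr>)"
    using exec.Output[of w inp 4 "s2\<lparr>regs := (regs s2)(4 := result q)\<rparr>"] by simp
  define s3 where
    "s3 = s2\<lparr>out := out s2 @ [result q], regs := (regs s2)(4 := result q, 3 := i - 1)\<rparr>"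
  have 6: "exec w inp (Op Sub 3 3 1)
      (s2\<lparr>regs := (regs s2)(4 := result q), out := out s2 @ [result q]\<rparr>) 1 s3"
    using exec.Op[of w inp Sub 3 3 1
        "s2\<lparr>regs := (regs s2)(4 := result q), out := out s2 @ [result q]\<rparr>"] sub3 regs2
    by (simp add: s3_def del: alu.simps)
  \<comment> \<open>Six single instructions around the loop, and its final failing test, add up to
    7.\<close>
  have "1 + (1 + (5 * length inp + 1 + (1 + (1 + (1 + 1))))) = 5 * length inp + 7" by simp
  moreover have "exec w inp run_automaton s (1 + (1 + (5 * length inp + 1 + (1 + (1 + (1 + 1)))))) s3"
    unfolding run_automaton_def by (intro exec.Seq[OF 1] exec.Seq[OF 2] exec.Seq[OF s2(1)]
        exec.Seq[OF 3] exec.Seq[OF 4] exec.Seq[OF 5] 6)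
  ultimately have "exec w inp run_automaton s (5 * length inp + 7) s3"
    by (simp only:)
  moreover have "regs s3 0 = length inp" "regs s3 1 = 1" "regs s3 2 = 0" "regs s3 3 = i - 1"
    "mem s3 = memory" "out s3 = out s @ [result q]"
    using regs2 s2 by (auto simp: s3_def s1_def)
  ultimately show ?thesis
    unfolding q_def by blast
qed

text \<open>Register 3 counts down, so the automata run in the order \<open>i, \<dots>, 1\<close>.
  Only the set of outputs matters, because a selection is a set and its names may be output
  repeatedly. The loop test raises 7 to 8.\<close>

lemma exec_run_automata_loop:
  assumes "set inp \<subseteq> {..<n}" "length inp < 2 ^ w"
    and "regs s 0 = length inp" "regs s 1 = 1" "regs s 2 = 0" "regs s 3 = i" "mem s = memory"
    and "i \<le> R"
  shows "\<exists>s'. exec w inp (While_nz 3 run_automaton) s (i * (5 * length inp + 8) + 1) s' \<and>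
           set (out s') = set (out s) \<union> (\<lambda>i. result (foldr step inp (start i))) ` {1..i}"
  using assms(3-)
proof (induction i arbitrary: s)
  case 0
  then show ?case using exec.While_False[of s 3 w inp run_automaton] by auto
next
  case (Suc i)
  obtain s1 where s1: "exec w inp run_automaton s (5 * length inp + 7) s1"
    "regs s1 0 = length inp" "regs s1 1 = 1" "regs s1 2 = 0" "regs s1 3 = i" "mem s1 = memory"
    "out s1 = out s @ [result (foldr step inp (start (Suc i)))]"
    using exec_run_automaton[OF assms(1,2) Suc.prems(1-5)] Suc.prems by auto
  obtain s2 where s2: "exec w inp (While_nz 3 run_automaton) s1 (i * (5 * length inp + 8) + 1) s2"
    "set (out s2) = set (out s1) \<union> (\<lambda>i. result (foldr step inp (start i))) ` {1..i}"
    using Suc.IH[OF s1(2-6)] Suc.prems by auto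
  have "exec w inp (While_nz 3 run_automaton) s
      (5 * length inp + 7 + (i * (5 * length inp + 8) + 1) + 1) s2"
    using exec.While_True[OF _ s1(1) s2(1)] Suc.prems by simp
  moreover have "5 * length inp + 7 + (i * (5 * length inp + 8) + 1) + 1
      = Suc i * (5 * length inp + 8) + 1" by simp
  moreover have "{1..Suc i} = insert (Suc i) {1..i}" by auto
  ultimately show ?case
    using s1 s2 by (intro exI[of _ s2]) auto
qed

lemma exec_run_automata:
  assumes "set inp \<subseteq> {..<n}" "length inp < 2 ^ w" "1 \<le> w" "memory = cell dat"
  shows "\<exists>s. exec w inp run_automata (init_state dat inp) (R * (5 * length inp + 8) + 3) s \<and>
           set (out s) = (\<lambda>i. result (foldr step inp (start i))) ` {1..R}"
proof -
  define s0 where "s0 = init_state dat inp"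
  \<comment> \<open>\<open>1 \<le> w\<close> prevents the constant 1 from being reduced to 0 modulo
    \<open>2 ^ w\<close>.\<close>
  have 1: "exec w inp (Const 1 1) s0 1 (s0\<lparr>regs := (regs s0)(1 := 1)\<rparr>)"
    using exec.Const[of w inp 1 1 s0] assms(3) by simp
  define s1 where "s1 = s0\<lparr>regs := (regs s0)(1 := 1, 3 := R)\<rparr>"
  \<comment> \<open>Register 2 still holds its initial 0 and serves as the address of the cell
    containing \<open>R\<close>.\<close>
  have 2: "exec w inp (Load 3 2) (s0\<lparr>regs := (regs s0)(1 := 1)\<rparr>) 1 s1"
    using exec.Load[of w inp 3 2 "s0\<lparr>regs := (regs s0)(1 := 1)\<rparr>"] memory_0 assms(4)
    by (simp add: s1_def s0_def init_state_def)
  obtain s2 where s2: "exec w inp (While_nz 3 run_automaton) s1 (R * (5 * length inp + 8) + 1) s2"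
    "set (out s2) = set (out s1) \<union> (\<lambda>i. result (foldr step inp (start i))) ` {1..R}"
    using exec_run_automata_loop[OF assms(1,2), of s1 R] assms(4)
    by (auto simp: s1_def s0_def init_state_def)
  have "1 + (1 + (R * (5 * length inp + 8) + 1)) = R * (5 * length inp + 8) + 3" by simp
  moreover have "exec w inp run_automata s0 (1 + (1 + (R * (5 * length inp + 8) + 1))) s2"
    unfolding run_automata_def by (intro exec.Seq[OF 1] exec.Seq[OF 2] s2(1))
  ultimately have "exec w inp run_automata s0 (R * (5 * length inp + 8) + 3) s2"
    by (simp only:)
  moreover have "out s1 = []" by (simp add: s1_def s0_def init_state_def)
  ultimately show ?thesis
    using s2(2) by (intro exI[of _ s2]) (simp add: s0_def)
qed

end

text \<open>Layout: \<open>R\<close>, then \<open>R\<close> start addresses, then one block of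
  \<open>n + 1\<close> cells per state, with its result first and its \<open>n\<close> successor
  addresses after it. Addresses lie below the total length, so every entry is a word.\<close>

lemma automaton_memory_exists:
  fixes Q :: "'q set"
  assumes "finite Q"
    and step_closed: "\<And>q a. q \<in> Q \<Longrightarrow> a < n \<Longrightarrow> step a q \<in> Q"
    and start_closed: "\<And>i. 1 \<le> i \<Longrightarrow> i \<le> R \<Longrightarrow> start i \<in> Q"
    and result_word: "\<And>q. q \<in> Q \<Longrightarrow> result q < 2 ^ w"
    and size_word: "1 + R + card Q * (n + 1) < 2 ^ w"
  shows "\<exists>dat base. fits w dat \<and> automaton_memory w n R Q step result start base (cell dat)"
proof -
  obtain num where num: "bij_betw num Q {..<card Q}"
    using assms(1) by (metis atLeast0LessThan ex_bij_betw_finite_nat)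
  define state where "state = inv_into Q num"
  \<comment> \<open>One past the first cell of the block, which is at
    \<open>R + 1 + num q * (n + 1)\<close> and stores the result.\<close>
  define base where "base = (\<lambda>q. R + 2 + num q * (n + 1))"
  define len where "len = 1 + R + card Q * (n + 1)"
  \<comment> \<open>Beyond the start addresses, quotient and remainder modulo \<open>n + 1\<close>
    recover the state and the position in its block.\<close>
  define entry where "entry = (\<lambda>p. if p = 0 then R else if p \<le> R then base (start p)
    else let q = state ((p - R - 1) div (n + 1)); r = (p - R - 1) mod (n + 1)
         in if r = 0 then result q else base (step (r - 1) q))"
  define dat where "dat = map entry [0..<len]"
  have numQ: "num q < card Q" "state (num q) = q" if "q \<in> Q" for q
    using num that by (auto simp: bij_betw_def state_def)
  have stateQ: "state x \<in> Q" if "x < card Q" for x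
    using num that by (auto simp: bij_betw_def state_def intro: inv_into_into)
  have base_len: "base q + n \<le> len" if "q \<in> Q" for q
  proof -
    have "(num q + 1) * (n + 1) \<le> card Q * (n + 1)"
      using numQ(1)[OF that] by (intro mult_right_mono) auto
    then show ?thesis by (simp add: base_def len_def)
  qed
  have cell: "cell dat p = entry p" if "p < len" for p
    using that by (simp add: cell_def dat_def)
  have block: "cell dat (R + 1 + num q * (n + 1) + r)
      = (if r = 0 then result q else base (step (r - 1) q))" if "q \<in> Q" "r \<le> n" for q r
  proof -
    have "R + 1 + num q * (n + 1) + r < len"
      using base_len[OF that(1)] that(2) by (simp add: base_def)
    moreover have "(R + 1 + num q * (n + 1) + r - R - 1) div (n + 1) = num q"
      "(R + 1 + num q * (n + 1) + r - R - 1) mod (n + 1) = r"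
      using that(2) by (auto simp del: mult_Suc_right)
    ultimately show ?thesis
      using numQ(2)[OF that(1)] by (subst cell) (simp_all add: entry_def Let_def)
  qed
  have "entry p < 2 ^ w" if "p < len" for p
  proof -
    have base_word: "base q < 2 ^ w" if "q \<in> Q" for q
      using base_len[OF that] size_word by (simp add: len_def)
    have "(p - R - 1) div (n + 1) < card Q" if "R < p"
      using \<open>p < len\<close> that by (intro less_mult_imp_div_less) (simp add: len_def)
    moreover have "(p - R - 1) mod (n + 1) - 1 < n" if "(p - R - 1) mod (n + 1) \<noteq> 0"
      using that mod_less_divisor[of "n + 1" "p - R - 1"] by linarith
    ultimately show ?thesis
      using size_word base_word start_closed result_word stateQ step_closed
      by (auto simp: entry_def Let_def)
  qed
  then have "fits w dat"
    using size_word by (auto simp: fits_def dat_def len_def)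
  moreover have "automaton_memory w n R Q step result start base (cell dat)"
  proof
    show "cell dat 0 = R" by (subst cell) (auto simp: len_def entry_def)
    show "cell dat i = base (start i)" if "1 \<le> i" "i \<le> R" for i
      using that by (subst cell) (auto simp: len_def entry_def)
    show "cell dat (base q + a) = base (step a q)" if "q \<in> Q" "a < n" for q a
      using block[of q "Suc a"] that by (simp add: base_def)
    show "cell dat (base q - 1) = result q" if "q \<in> Q" for q
      using block[of q 0] that by (simp add: base_def)
    show "base q + n < 2 ^ w" if "q \<in> Q" for q
      using base_len[OF that] size_word by (simp add: len_def)
  qed (use assms in \<open>auto simp: base_def\<close>)
  ultimately show ?thesis by blast
qed

section \<open>Coverings from hash functions\<close>

text \<open>The guard keeps the state set of the automaton finite and closed on arbitrary input words.\<close>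

definition bounded_insert :: "nat \<Rightarrow> nat \<Rightarrow> nat \<Rightarrow> nat set \<Rightarrow> nat set" where
  "bounded_insert m f y S = (if y < m \<and> card (insert y S) \<le> f then insert y S else S)"

text \<open>
  States consist of the index of a hash function, the buckets hit so far, and the target of an
  edge whose source is still to be read (the input is read backwards).
\<close>

fun hash_step :: "failure_kind \<Rightarrow> (nat \<Rightarrow> elt \<Rightarrow> nat) \<Rightarrow> nat \<Rightarrow> nat \<Rightarrow>
    nat \<Rightarrow> nat \<times> nat set \<times> nat option \<Rightarrow> nat \<times> nat set \<times> nat option" where
  "hash_step Vertex_Failures h m f a (i, S, b) = (i, bounded_insert m f (h i (Vertex a)) S, None)"
| "hash_step Edge_Failures h m f a (i, S, None) = (i, S, Some a)"
| "hash_step Edge_Failures h m f a (i, S, Some b) =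
     (i, bounded_insert m f (h i (Edge a b)) S, None)"

text \<open>On a genuine query the guard in \<open>bounded_insert\<close> always succeeds: hash
  values lie below \<open>m\<close>, and at most \<open>length xs\<close> buckets are hit. After
  each complete element no edge target is pending, so the induction proceeds element by
  element.\<close>

lemma foldr_hash_step:
  assumes "set xs \<subseteq> elements k G" "length xs \<le> f" "\<And>x. x \<in> elements k G \<Longrightarrow> h i x < m"
  shows "foldr (hash_step k h m f) (concat (map encode xs)) (i, {}, None) = (i, h i ` set xs, None)"
  using assms(1,2)
proof (induction xs)
  case Nil
  then show ?case by simp
next
  case (Cons x xs)
  have "card (insert (h i x) (h i ` set xs)) \<le> f"
  proof -
    have "card (h i ` set (x # xs)) \<le> length (x # xs)"
      by (meson List.finite_set card_image_le card_length le_trans)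
    then show ?thesis using Cons.prems(2) by simp
  qed
  then have "bounded_insert m f (h i x) (h i ` set xs) = h i ` set (x # xs)"
    using Cons.prems assms(3)[of x] by (simp add: bounded_insert_def)
  moreover have "foldr (hash_step k h m f) (encode x) (i, S, None)
      = (i, bounded_insert m f (h i x) S, None)" for S
    using Cons.prems(1) by (cases k) auto
  ultimately show ?case
    using Cons by simp
qed

text \<open>The greedy cover is applied to the triples \<open>(F, s, t)\<close> that admit a short
  shortest path. By the choice of \<open>R\<close>, fewer than one triple remains uncovered, hence
  none.\<close>

lemma exists_replacement_hashes:
  fixes f L n R :: nat
  assumes G: "wf_graph G" "verts G = {..<n}" and n: "2 \<le> n"
    and R: "(1 - exp (- real f)) ^ R * real n ^ (3 * f + 2) < 1"
  shows "\<exists>hs. length hs = R \<and> (\<forall>h \<in> set hs. \<forall>x \<in> elements k G. h x < L + 1 + f) \<and>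
    (\<forall>F s t. F \<subseteq> elements k G \<and> card F \<le> f \<and> s \<in> verts G \<and> t \<in> verts G \<and>
       (\<exists>p. shortest_path (remove G F) s t p \<and> num_edges p \<le> L) \<longrightarrow>
       (\<exists>h \<in> set hs. \<exists>p. shortest_path (remove G F) s t p \<and> num_edges p \<le> L \<and>
          h ` path_elements k G p \<inter> h ` F = {}))"
proof -
  define U where "U = elements k G"
  have U: "finite U" "card U \<le> n\<^sup>2" using elements_bound[OF G] by (auto simp: U_def)
  define short where "short = (\<lambda>(F, s, t) p. shortest_path (remove G F) s t p \<and> num_edges p \<le> L)"
  \<comment> \<open>Only one short shortest path per triple has to be separated from
    \<open>F\<close>.\<close>
  define path where "path = (\<lambda>x. SOME p. short x p)"
  have path: "short x (path x)" if "\<exists>p. short x p" for x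
    using someI_ex[OF that] by (simp add: path_def)
  define Fs where "Fs = {F. F \<subseteq> U \<and> card F \<le> f}"
  have finFs: "finite Fs" using U by (auto simp: Fs_def)
  define X where "X = {x \<in> Fs \<times> {..<n} \<times> {..<n}. \<exists>p. short x p}"
  have finX: "finite X" using finFs by (auto simp: X_def)
  define H where "H = (U \<rightarrow>\<^sub>E {..<L + 1 + f})"
  have H: "finite H" "H \<noteq> {}" using U by (auto simp: H_def PiE_eq_empty_iff intro!: finite_PiE)
  define good where "good = (\<lambda>(h :: elt \<Rightarrow> nat) x. h ` path_elements k G (path x) \<inter> h ` fst x = {})"
  have "\<exists>hs. length hs = R \<and> set hs \<subseteq> H \<and>
      real (card {x \<in> X. \<forall>h \<in> set hs. \<not> good h x}) \<le> (1 - exp (- real f)) ^ R * real (card X)"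
  proof (rule greedy_cover[OF H finX])
    show "exp (- real f) \<le> 1" by simp
    fix x assume x: "x \<in> X"
    obtain F s t where [simp]: "x = (F, s, t)" by (cases x)
    have sp: "shortest_path (remove G F) s t (path x)" "num_edges (path x) \<le> L"
      using path[of x] x by (auto simp: X_def short_def)
    show "exp (- real f) * real (card H) \<le> real (card {h \<in> H. good h x})"
      unfolding H_def good_def fst_conv \<open>x = (F, s, t)\<close>
    proof (rule card_separating_hashes[OF U(1)])
      show "F \<subseteq> U" "card F \<le> f" using x by (auto simp: X_def Fs_def)
      show "path_elements k G (path (F, s, t)) \<subseteq> U" by (auto simp: path_elements_def U_def)
      show "F \<inter> path_elements k G (path (F, s, t)) = {}"
        using sp(1) path_elements_disjoint[of G F s t] by (simp add: shortest_path_def)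
      show "card (path_elements k G (path (F, s, t))) \<le> L + 1"
        using card_path_elements_le[OF sp(2)] by simp
    qed simp
  qed
  then obtain hs where hs: "length hs = R" "set hs \<subseteq> H"
    "real (card {x \<in> X. \<forall>h \<in> set hs. \<not> good h x}) \<le> (1 - exp (- real f)) ^ R * real (card X)"
    by blast
  \<comment> \<open>There are at most \<open>(n ^ 2 + 1) ^ f \<le> n ^ (3 * f)\<close> failure sets,
    as \<open>2 \<le> n\<close>, and \<open>n ^ 2\<close> endpoint pairs.\<close>
  have "card X \<le> n ^ (3 * f + 2)"
  proof -
    have "n\<^sup>2 + 1 \<le> n ^ 3"
    proof -
      have "1 * 1 \<le> n\<^sup>2 * (n - 1)" using n by (intro mult_mono) auto
      then show ?thesis using n by (cases n) (auto simp: power2_eq_square power3_eq_cube)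
    qed
    have "card Fs = (\<Sum>i\<le>f. card U choose i)"
      unfolding Fs_def by (rule card_subsets_card_le[OF U(1)])
    also have "\<dots> \<le> (card U + 1) ^ f" by (rule sum_choose_le_power)
    also have "\<dots> \<le> (n ^ 3) ^ f"
      using U(2) \<open>n\<^sup>2 + 1 \<le> n ^ 3\<close> by (intro power_mono) auto
    finally have Fs: "card Fs \<le> n ^ (3 * f)" by (simp add: power_mult)
    have "card X \<le> card (Fs \<times> {..<n} \<times> {..<n})"
      using finFs by (intro card_mono) (auto simp: X_def)
    also have "\<dots> = card Fs * n\<^sup>2" by (simp add: card_cartesian_product power2_eq_square)
    also have "\<dots> \<le> n ^ (3 * f) * n\<^sup>2" using Fs by (intro mult_right_mono) auto
    finally show ?thesis by (simp add: power_add power2_eq_square mult_ac)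
  qed
  then have "real (card X) \<le> real n ^ (3 * f + 2)"
    by (metis of_nat_le_iff of_nat_power)
  then have "(1 - exp (- real f)) ^ R * real (card X)
      \<le> (1 - exp (- real f)) ^ R * real n ^ (3 * f + 2)"
    by (intro mult_left_mono) auto
  then have "card {x \<in> X. \<forall>h \<in> set hs. \<not> good h x} = 0"
    using hs(3) R by linarith
  then have "{x \<in> X. \<forall>h \<in> set hs. \<not> good h x} = {}"
    using finX by (subst (asm) card_0_eq) auto
  then have cov: "\<exists>h \<in> set hs. good h x" if "x \<in> X" for x
    using that by blast
  show ?thesis
  proof (intro exI conjI allI impI)
    show "length hs = R" by (rule hs)
    show "\<forall>h \<in> set hs. \<forall>x \<in> elements k G. h x < L + 1 + f"
      using hs(2) by (auto simp: H_def U_def PiE_iff subset_iff)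
    fix F s t
    assume a: "F \<subseteq> elements k G \<and> card F \<le> f \<and> s \<in> verts G \<and> t \<in> verts G \<and>
       (\<exists>p. shortest_path (remove G F) s t p \<and> num_edges p \<le> L)"
    then have "(F, s, t) \<in> X" using G by (auto simp: X_def Fs_def U_def short_def)
    then obtain h where "h \<in> set hs" "good h (F, s, t)" using cov by blast
    then show "\<exists>h \<in> set hs. \<exists>p. shortest_path (remove G F) s t p \<and> num_edges p \<le> L \<and>
          h ` path_elements k G p \<inter> h ` F = {}"
      using path[of "(F, s, t)"] a by (auto simp: good_def short_def)
  qed
qed

text \<open>\<open>cv\<close> counts the pairs of a hash function and a set of at most
  \<open>f\<close> buckets. A query has at most \<open>2 * f\<close> symbols, which turns
  \<open>5 * length inp + 8\<close> into \<open>10 * f + 8\<close>. With \<open>z = n + cv\<close>,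
  the table has at most \<open>z + z ^ 3\<close> cells and the input at most \<open>z ^ 3\<close>,
  so words up to \<open>z ^ 4\<close> suffice.\<close>

lemma exists_covering:
  fixes f L n R w :: nat
  assumes G: "wf_graph G" "verts G = {..<n}" and n: "2 \<le> n"
    and R: "(1 - exp (- real f)) ^ R * real n ^ (3 * f + 2) < 1"
  defines "cv \<equiv> R * (\<Sum>i\<le>f. (L + 1 + f) choose i)"
  assumes w: "(n + cv) ^ 4 < 2 ^ w"
  shows "\<exists>C. is_covering k G L f C \<and> covering_value C \<le> cv \<and>
    query_time_le k G f run_automata w C (R * (10 * f + 8) + 3) \<and> selection_size_le k G f C R"
proof -
  obtain hs where hs: "length hs = R" "\<forall>h \<in> set hs. \<forall>x \<in> elements k G. h x < L + 1 + f"
    and sep: "\<forall>F s t. F \<subseteq> elements k G \<and> card F \<le> f \<and> s \<in> verts G \<and> t \<in> verts G \<and>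
       (\<exists>p. shortest_path (remove G F) s t p \<and> num_edges p \<le> L) \<longrightarrow>
       (\<exists>h \<in> set hs. \<exists>p. shortest_path (remove G F) s t p \<and> num_edges p \<le> L \<and>
          h ` path_elements k G p \<inter> h ` F = {})"
    using exists_replacement_hashes[OF G n R, of k L] by (elim exE conjE) (rule that; assumption)
  define m where "m = L + 1 + f"
  \<comment> \<open>Numbering starts at 1 because cells 1 to \<open>R\<close> hold the start states
    and the countdown stops at 0.\<close>
  define h where "h = (\<lambda>i. hs ! (i - 1))"
  have h: "h i \<in> set hs" if "i \<in> {1..R}" for i
    using that hs(1) by (auto simp: h_def)
  have h_onto: "\<exists>i \<in> {1..R}. g = h i" if g: "g \<in> set hs" for g
  proof -
    obtain j where "j < R" "g = hs ! j" using g hs(1) by (auto simp: in_set_conv_nth)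
    then show ?thesis by (intro bexI[of _ "Suc j"]) (auto simp: h_def)
  qed
  have h_lt: "h i x < m" if "i \<in> {1..R}" "x \<in> elements k G" for i x
    using h[OF that(1)] hs(2) that(2) by (auto simp: m_def)
  define Sub where "Sub = {S. S \<subseteq> {..<m} \<and> card S \<le> f}"
  have Sub: "finite Sub" "card Sub = (\<Sum>i\<le>f. m choose i)"
    using card_subsets_card_le[of "{..<m}" f] by (auto simp: Sub_def)
  have finSub: "finite S" if "S \<in> Sub" for S using that finite_subset by (auto simp: Sub_def)
  have cv: "cv = R * card Sub" by (simp add: cv_def Sub(2) m_def)
  have hF: "h i ` F \<in> Sub" if "i \<in> {1..R}" "F \<subseteq> elements k G" "card F \<le> f" for i F
  proof -
    have "finite F" using that(2) elements_bound(1)[OF G] finite_subset by blast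
    then have "card (h i ` F) \<le> f" using card_image_le that(3) order_trans by blast
    then show ?thesis using h_lt that by (auto simp: Sub_def)
  qed
  define sub where "sub = (\<lambda>i S. remove G {x \<in> elements k G. h i x \<in> S})"
  define \<G> where "\<G> = case_prod sub ` ({1..R} \<times> Sub)"
  have fin\<G>: "finite \<G>" using Sub by (simp add: \<G>_def)
  have card\<G>: "card \<G> \<le> cv"
    using card_image_le[of "{1..R} \<times> Sub" "case_prod sub"] Sub by (simp add: \<G>_def cv)
  obtain Gs where Gs: "set Gs = \<G>" "distinct Gs" using finite_distinct_list[OF fin\<G>] by blast
  have lenGs: "length Gs \<le> cv" using Gs card\<G> distinct_card by fastforce
  \<comment> \<open>Different pairs \<open>(i, S)\<close> may give the same graph;
    \<open>pos\<close> names it by its position in the duplicate-free list.\<close>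
  define pos where "pos = (\<lambda>A. SOME j. j < length Gs \<and> Gs ! j = A)"
  have pos: "pos A < length Gs" "Gs ! pos A = A" if "A \<in> \<G>" for A
    using that someI_ex[of "\<lambda>j. j < length Gs \<and> Gs ! j = A"]
    by (auto simp: pos_def in_set_conv_nth simp flip: Gs(1))
  have sub\<G>: "sub i S \<in> \<G>" if "i \<in> {1..R}" "S \<in> Sub" for i S
    using that by (auto simp: \<G>_def)
  define sel where "sel = (\<lambda>F. (\<lambda>i. sub i (h i ` F)) ` {1..R})"
  define Q where "Q = {1..R} \<times> Sub \<times> insert None (Some ` {..<n})"
  define result where "result = (\<lambda>(i, S, b :: nat option). pos (sub i S))"
  define start where "start = (\<lambda>i :: nat. (i, {} :: nat set, None :: nat option))"
  \<comment> \<open>For \<open>R = 0\<close> the hypothesis would read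
    \<open>n ^ (3 * f + 2) < 1\<close>.\<close>
  have "1 \<le> R" using R n one_le_power[of "real n" "3 * f + 2"] by (cases R) auto
  moreover have "{} \<in> Sub" by (simp add: Sub_def)
  then have "1 \<le> card Sub" using Sub(1) by (metis One_nat_def Suc_leI card_gt_0_iff empty_iff)
  ultimately have R_cv: "R \<le> cv" "1 \<le> cv" by (auto simp: cv)
  define z where "z = n + cv"
  have z: "n + 1 \<le> z" "cv + 1 \<le> z" "2 \<le> z" using n R_cv by (auto simp: z_def)
  have z4: "z + z ^ 3 \<le> z ^ 4"
  proof -
    have "z * 1 \<le> z * z\<^sup>2" using z by (intro mult_left_mono) auto
    then have "z + z ^ 3 \<le> 2 * z ^ 3" by (simp add: power3_eq_cube power2_eq_square)
    also have "\<dots> \<le> z * z ^ 3" using z by (intro mult_right_mono) auto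
    finally show ?thesis by (simp add: eval_nat_numeral)
  qed
  have w4: "z ^ 4 < 2 ^ w" using w by (simp add: z_def)
  have cv_w: "cv < 2 ^ w"
  proof -
    have "cv < z" using z by simp
    also have "z \<le> z ^ 4" using z z4 by linarith
    finally show ?thesis using w4 by simp
  qed
  have "\<exists>dat base. fits w dat \<and>
      automaton_memory w n R Q (hash_step k h m f) result start base (cell dat)"
  proof (rule automaton_memory_exists)
    show "finite Q" using Sub(1) by (simp add: Q_def)
    show "hash_step k h m f a q \<in> Q" if "q \<in> Q" "a < n" for q a
    proof -
      obtain i S b where q: "q = (i, S, b)" by (cases q)
      have "bounded_insert m f y S \<in> Sub" for y
        using that q by (auto simp: Q_def Sub_def bounded_insert_def)
      then show ?thesis
        using that q by (cases k; cases b) (auto simp: Q_def)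
    qed
    show "start i \<in> Q" if "1 \<le> i" "i \<le> R" for i
      using that by (auto simp: start_def Q_def Sub_def)
    show "result q < 2 ^ w" if "q \<in> Q" for q
    proof -
      obtain i S b where q: "q = (i, S, b)" by (cases q)
      then have "pos (sub i S) < length Gs" using that by (auto simp: Q_def intro!: pos sub\<G>)
      then show ?thesis using q lenGs cv_w by (simp add: result_def)
    qed
    have "card Q = cv * (n + 1)"
      using Sub(1) by (simp add: Q_def cv card_cartesian_product card_image algebra_simps)
    then have "1 + R + card Q * (n + 1) = 1 + R + cv * ((n + 1) * (n + 1))"
      by (simp only: mult.assoc)
    also have "\<dots> \<le> z + z * (z * z)"
      using z R_cv by (intro add_mono mult_mono) auto
    also have "\<dots> \<le> z ^ 4" using z4 by (simp add: power3_eq_cube mult.assoc)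
    finally show "1 + R + card Q * (n + 1) < 2 ^ w" using w4 by simp
  qed
  then obtain dat base where dat: "fits w dat"
    "automaton_memory w n R Q (hash_step k h m f) result start base (cell dat)"
    by blast
  define C where "C = \<lparr>family = Gs, select = sel, data = dat\<rparr>"
  have "1 \<le> w" using cv_w R_cv by (cases w) auto
  have "is_covering k G L f C"
    unfolding is_covering_def replacement_path_covering_def
  proof (intro conjI ballI allI impI)
    show "distinct (family C)" using Gs by (simp add: C_def)
    fix A assume "A \<in> set (family C)"
    then obtain i S where A: "A = sub i S" by (auto simp: C_def Gs \<G>_def)
    have "subgraph A G" unfolding A sub_def by (rule subgraph_remove[OF G(1)])
    moreover have "verts A = verts G" if "k = Edge_Failures"
      using that by (auto simp: A sub_def)
    ultimately show "case k of Edge_Failures \<Rightarrow> spanning_subgraph A G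
        | Vertex_Failures \<Rightarrow> subgraph A G"
      by (cases k) (auto simp: spanning_subgraph_def)
  next
    fix F assume F: "F \<subseteq> elements k G \<and> card F \<le> f"
    show "select C F \<subseteq> set (family C)"
      using F by (auto simp: C_def Gs sel_def intro!: sub\<G> hF)
    show "\<not> contains A x" if "A \<in> select C F" "x \<in> F" for A x
      using that F by (auto simp: C_def sel_def sub_def intro!: not_contains_remove)
    fix s t assume st: "s \<in> verts G" "t \<in> verts G"
      "\<exists>p. shortest_path (remove G F) s t p \<and> num_edges p \<le> L"
    then obtain g p where gp: "g \<in> set hs" "shortest_path (remove G F) s t p" "num_edges p \<le> L"
      "g ` path_elements k G p \<inter> g ` F = {}"
      using sep[rule_format, of F s t] F by blast
    then obtain i where i: "i \<in> {1..R}" "g = h i" using h_onto by blast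
    have "is_path (sub i (h i ` F)) s t p"
      unfolding sub_def
    proof (rule is_path_remove_transfer)
      show "is_path (remove G F) s t p" using gp by (simp add: shortest_path_def)
      show "{x \<in> elements k G. h i x \<in> h i ` F} \<subseteq> elements k G" by blast
      show "{x \<in> elements k G. h i x \<in> h i ` F} \<inter> path_elements k G p = {}"
        using gp(4) i(2) by blast
    qed
    moreover have "sub i (h i ` F) \<in> select C F" using i by (auto simp: C_def sel_def)
    ultimately show "\<exists>A \<in> select C F. \<exists>p. shortest_path (remove G F) s t p \<and>
        num_edges p \<le> L \<and> is_path A s t p"
      using gp by blast
  qed
  moreover have "covering_value C \<le> cv"
    using card\<G> by (simp add: covering_value_def C_def Gs)
  moreover have "selection_size_le k G f C R"
  proof -
    have "card (sel F) \<le> R" for F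
      using card_image_le[of "{1..R}" "\<lambda>i. sub i (h i ` F)"] by (simp add: sel_def)
    then show ?thesis by (simp add: selection_size_le_def C_def)
  qed
  moreover have "query_time_le k G f run_automata w C (R * (10 * f + 8) + 3)"
    unfolding query_time_le_def Let_def
  proof (intro conjI allI impI)
    show "fits w (data C)" using dat by (simp add: C_def)
    fix xs assume xs: "distinct xs \<and> set xs \<subseteq> elements k G \<and> length xs \<le> f"
    define inp where "inp = concat (map encode xs)"
    have inp: "set inp \<subseteq> {..<n}" "length inp \<le> 2 * length xs"
      using encode_bounds[OF G, of xs k] xs by (auto simp: inp_def)
    \<comment> \<open>Failures are distinct, so the input length is bounded in terms of
      \<open>n\<close> alone.\<close>
    have "length xs \<le> n\<^sup>2"
      using xs elements_bound[OF G, of k] by (metis card_mono distinct_card le_trans)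
    then have "length inp \<le> 2 * n\<^sup>2" using inp by simp
    also have "\<dots> \<le> z * z\<^sup>2" using z by (intro mult_mono power_mono) auto
    also have "\<dots> \<le> z ^ 4" using z4 by (simp add: power3_eq_cube power2_eq_square)
    finally have len: "length inp < 2 ^ w" using w4 by simp
    have "n < 2 ^ w"
    proof -
      have "n \<le> z" using z by simp
      also have "z \<le> z ^ 4" using z4 by simp
      finally show ?thesis using w4 by simp
    qed
    then show "fits w (concat (map encode xs))"
      using len inp(1) unfolding fits_def inp_def[symmetric] by auto
    obtain s where s: "exec w inp run_automata (init_state dat inp) (R * (5 * length inp + 8) + 3) s"
      "set (out s) = (\<lambda>i. result (foldr (hash_step k h m f) inp (start i))) ` {1..R}"
      using automaton_memory.exec_run_automata[OF dat(2) inp(1) len \<open>1 \<le> w\<close> refl] by blast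
    have res: "result (foldr (hash_step k h m f) inp (start i)) = pos (sub i (h i ` set xs))"
      if "i \<in> {1..R}" for i
      using foldr_hash_step[of xs k G f h i m] xs h_lt[OF that]
      by (simp add: start_def inp_def result_def)
    have card: "card (set xs) \<le> f" using xs distinct_card by fastforce
    have out: "set (out s) = (\<lambda>i. pos (sub i (h i ` set xs))) ` {1..R}"
      unfolding s(2) using res by (intro image_cong) auto
    have in\<G>: "sub i (h i ` set xs) \<in> \<G>" if "i \<in> {1..R}" for i
      using that xs card by (intro sub\<G> hF) auto
    have "R * (5 * length inp + 8) + 3 \<le> R * (10 * f + 8) + 3"
      using inp xs by (intro add_mono mult_left_mono) auto
    moreover have "set (out s) \<subseteq> {..<length (family C)}"
      unfolding out using pos(1)[OF in\<G>] by (auto simp: C_def)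
    moreover have "(\<lambda>i. family C ! i) ` set (out s) = select C (set xs)"
      unfolding out using pos(2)[OF in\<G>] by (force simp: C_def sel_def image_image)
    ultimately show "\<exists>t s. exec w (concat (map encode xs)) run_automata
        (init_state (data C) (concat (map encode xs))) t s \<and> t \<le> R * (10 * f + 8) + 3 \<and>
        set (out s) \<subseteq> {..<length (family C)} \<and>
        (\<lambda>i. family C ! i) ` set (out s) = select C (set xs)"
      using s(1) unfolding inp_def[symmetric]
      by (intro exI[of _ "R * (5 * length inp + 8) + 3"] exI[of _ s] conjI) (simp_all add: C_def)
  qed
  ultimately show ?thesis by blast
qed

section \<open>Asymptotics\<close>

text \<open>\<open>1 - x \<le> exp (- x)\<close> with \<open>x = exp (- f)\<close> bounds the first
  factor by \<open>exp (- R * x)\<close>, and \<open>R * x\<close> exceeds the logarithm of the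
  second factor.\<close>

lemma failure_probability:
  fixes f n R :: nat
  assumes "1 \<le> n" "real (3 * f + 2) * ln (real n) * exp (real f) < real R"
  shows "(1 - exp (- real f)) ^ R * real n ^ (3 * f + 2) < 1"
proof -
  have "real (3 * f + 2) * ln (real n) < real R * exp (- real f)"
    using assms(2) by (simp add: exp_minus field_simps)
  then have "exp (real (3 * f + 2) * ln (real n)) < exp (real R * exp (- real f))"
    by simp
  moreover have "exp (real (3 * f + 2) * ln (real n)) = real n ^ (3 * f + 2)"
    unfolding exp_of_nat_mult using assms(1) by simp
  ultimately have n: "real n ^ (3 * f + 2) < exp (real R * exp (- real f))" by (simp only:)
  have "(1 - exp (- real f)) ^ R \<le> exp (- exp (- real f)) ^ R"
    using exp_ge_add_one_self[of "- exp (- real f)"] by (intro power_mono) auto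
  also have "\<dots> = exp (- (real R * exp (- real f)))"
    by (simp flip: exp_of_nat_mult)
  finally have "(1 - exp (- real f)) ^ R * real n ^ (3 * f + 2)
      \<le> exp (- (real R * exp (- real f))) * real n ^ (3 * f + 2)"
    by (intro mult_right_mono) auto
  also have "\<dots> < exp (- (real R * exp (- real f))) * exp (real R * exp (- real f))"
    using n by (intro mult_strict_left_mono) auto
  finally show ?thesis by (simp flip: exp_add)
qed

lemma ln_of_nat_ge_one_eventually: "\<forall>\<^sub>F n in sequentially. ln (real n) \<ge> 1"
proof (rule eventually_sequentiallyI[of 3])
  fix n :: nat assume "3 \<le> n"
  then have "exp 1 \<le> real n" using exp_le by linarith
  then show "1 \<le> ln (real n)" using \<open>3 \<le> n\<close> by (subst ln_ge_iff) auto
qed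

text \<open>The factor \<open>K * exp (a * f) * ln n\<close> equals \<open>n powr \<delta>\<close>
  when \<open>\<delta>\<close> is its logarithm divided by \<open>ln n\<close>; each of the three
  summands of \<open>\<delta>\<close> tends to 0.\<close>

lemma up_to_subpolyI:
  fixes f h :: "nat \<Rightarrow> nat" and g :: "nat \<Rightarrow> real"
  assumes f: "(\<lambda>n. real (f n)) \<in> o(\<lambda>n. ln (real n))" and "K > 0"
    and le: "\<forall>\<^sub>F n in sequentially. real (h n) \<le> g n * (K * exp (a * real (f n)) * ln (real n))"
  shows "h \<in> up_to_subpoly g"
proof -
  define \<delta> where "\<delta> = (\<lambda>n. (ln K + a * real (f n) + ln (ln (real n))) / ln (real n))"
  have lim_f: "((\<lambda>n. real (f n) / ln (real n)) \<longlongrightarrow> 0) sequentially"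
    using f by (rule smalloD_tendsto)
  have ln_top: "filterlim (\<lambda>n. ln (real n)) at_top sequentially"
    by (rule filterlim_compose[OF ln_at_top filterlim_real_sequentially])
  have lim_K: "((\<lambda>n. ln K / ln (real n)) \<longlongrightarrow> 0) sequentially"
    by (rule real_tendsto_divide_at_top[OF tendsto_const ln_top])
  have lim_ln: "((\<lambda>n. ln (ln (real n)) / ln (real n)) \<longlongrightarrow> 0) sequentially"
    using filterlim_compose[OF ln_x_over_x_tendsto_0 ln_top] .
  have "((\<lambda>n. ln K / ln (real n) + a * (real (f n) / ln (real n)) + ln (ln (real n)) / ln (real n))
      \<longlongrightarrow> 0 + a * 0 + 0) sequentially"
    by (intro tendsto_intros lim_f lim_K lim_ln)
  then have "(\<delta> \<longlongrightarrow> 0) sequentially"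
    by (simp add: \<delta>_def add_divide_distrib)
  then have "\<delta> \<in> o(\<lambda>_. 1)" by (intro smalloI_tendsto) auto
  moreover have "\<forall>\<^sub>F n in sequentially. real (h n) \<le> g n * real n powr \<delta> n"
    using le ln_of_nat_ge_one_eventually eventually_gt_at_top[of 1]
  proof eventually_elim
    case (elim n)
    have "real n powr \<delta> n = exp (ln K + a * real (f n) + ln (ln (real n)))"
      using elim by (auto simp: powr_def \<delta>_def)
    also have "\<dots> = K * exp (a * real (f n)) * ln (real n)"
      using elim \<open>K > 0\<close> by (simp add: exp_add)
    finally show ?case using elim by simp
  qed
  ultimately show ?thesis unfolding up_to_subpoly_def by blast
qed

lemma soft_OI:
  assumes "\<forall>\<^sub>F n in sequentially. real (h n) \<le> K * (g n * ln (real n))"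
  shows "h \<in> soft_O g"
proof -
  have "(\<lambda>n. real (h n)) \<in> O(\<lambda>n. g n * ln (real n) ^ 1)"
  proof (rule bigoI)
    show "\<forall>\<^sub>F n in sequentially. norm (real (h n)) \<le> \<bar>K\<bar> * norm (g n * ln (real n) ^ 1)"
      using assms
    proof eventually_elim
      case (elim n)
      also have "K * (g n * ln (real n)) \<le> \<bar>K * (g n * ln (real n))\<bar>" by simp
      finally show ?case by (simp add: abs_mult)
    qed
  qed
  then show ?thesis unfolding soft_O_def by blast
qed

text \<open>Solving for the exponent gives \<open>\<epsilon> = a * f / ln (L / f)\<close>.
  Eventually \<open>ln f \<le> f \<le> ln L / 2\<close>, so \<open>ln (L / f) \<ge> ln L / 2\<close>
  and \<open>\<epsilon>\<close> tends to 0.\<close>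

lemma exp_absorbed:
  fixes f L :: "nat \<Rightarrow> nat"
  assumes "\<forall>n. 1 \<le> f n" "(\<lambda>n. real (f n)) \<in> o(\<lambda>n. ln (real (L n)))"
  shows "\<exists>\<epsilon> \<in> o(\<lambda>_. 1). \<forall>\<^sub>F n in sequentially.
    f n \<le> L n \<and> exp (a * real (f n)) = (real (L n) / real (f n)) powr \<epsilon> n"
proof -
  define \<epsilon> where "\<epsilon> = (\<lambda>n. a * real (f n) / ln (real (L n) / real (f n)))"
  have "\<forall>\<^sub>F n in sequentially. norm (real (f n)) \<le> 1 / 2 * norm (ln (real (L n)))"
    using landau_o.smallD[OF assms(2), of "1 / 2"] by simp
  then have ev: "\<forall>\<^sub>F n in sequentially. f n \<le> L n \<and> 0 < ln (real (L n)) \<and>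
      ln (real (L n)) / 2 \<le> ln (real (L n) / real (f n))"
  proof eventually_elim
    case (elim n)
    have f1: "1 \<le> real (f n)" using assms(1) by simp
    have "L n \<noteq> 0" using elim f1 by (intro notI) simp
    then have L: "0 < real (L n)" "0 \<le> ln (real (L n))" by auto
    then have le: "real (f n) \<le> ln (real (L n)) / 2" using elim by simp
    have "ln (real (f n)) \<le> real (f n)" using f1 ln_le_minus_one[of "real (f n)"] by linarith
    then have "ln (real (L n)) / 2 \<le> ln (real (L n) / real (f n))"
      using le f1 L by (simp add: ln_div)
    moreover have "ln (real (L n)) \<le> real (L n)" using ln_le_minus_one[of "real (L n)"] L by linarith
    then have "f n \<le> L n" using le L by linarith
    moreover have "0 < ln (real (L n))" using le f1 by linarith
    ultimately show ?case by blast
  qed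
  have "((\<lambda>n. real (f n) / ln (real (L n))) \<longlongrightarrow> 0) sequentially"
    using assms(2) by (rule smalloD_tendsto)
  then have "((\<lambda>n. 2 * \<bar>a\<bar> * (real (f n) / ln (real (L n)))) \<longlongrightarrow> 2 * \<bar>a\<bar> * 0) sequentially"
    by (intro tendsto_intros)
  then have lim: "((\<lambda>n. 2 * \<bar>a\<bar> * (real (f n) / ln (real (L n)))) \<longlongrightarrow> 0) sequentially" by simp
  have "(\<epsilon> \<longlongrightarrow> 0) sequentially"
  proof (rule Lim_null_comparison[OF _ lim])
    show "\<forall>\<^sub>F n in sequentially. norm (\<epsilon> n) \<le> 2 * \<bar>a\<bar> * (real (f n) / ln (real (L n)))"
      using ev
    proof eventually_elim
      case (elim n)
      then have "\<bar>a\<bar> * real (f n) / ln (real (L n) / real (f n)) \<le> \<bar>a\<bar> * real (f n) / (ln (real (L n)) / 2)"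
        by (intro divide_left_mono mult_pos_pos) auto
      then show ?case using elim by (simp add: \<epsilon>_def abs_mult mult_ac)
    qed
  qed
  then have "\<epsilon> \<in> o(\<lambda>_. 1)" by (intro smalloI_tendsto) auto
  moreover have "\<forall>\<^sub>F n in sequentially.
    f n \<le> L n \<and> exp (a * real (f n)) = (real (L n) / real (f n)) powr \<epsilon> n"
    using ev
  proof eventually_elim
    case (elim n)
    have "0 < f n" using assms(1) by (simp add: Suc_le_eq)
    then have "real (L n) / real (f n) \<noteq> 0" "ln (real (L n) / real (f n)) \<noteq> 0" using elim by auto
    then show ?case using elim by (simp add: powr_def \<epsilon>_def)
  qed
  ultimately show ?thesis by blast
qed

text \<open>\<open>L + 1 + f \<le> 3 * L \<le> exp 2 * L\<close> contributes
  \<open>exp (2 * f)\<close>; the remaining \<open>exp f\<close> comes from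
  \<open>sum_choose_le_exp\<close>.\<close>

lemma sum_choose_bucket_sets_le:
  assumes "1 \<le> f" "f \<le> L"
  shows "real (\<Sum>i\<le>f. (L + 1 + f) choose i) \<le> (real L / real f) ^ f * exp (3 * real f)"
proof -
  have e2: "(3::real) \<le> exp 2" using exp_ge_add_one_self[of 2] by simp
  have "real (L + 1 + f) / real f \<le> real L / real f * exp 2"
  proof -
    have "real (L + 1 + f) \<le> real L * 3" using assms by simp
    also have "\<dots> \<le> real L * exp 2" using e2 by (intro mult_left_mono) auto
    finally show ?thesis using assms by (simp add: divide_right_mono)
  qed
  then have "(real (L + 1 + f) / real f) ^ f \<le> (real L / real f * exp 2) ^ f"
    by (intro power_mono) auto
  also have "\<dots> = (real L / real f) ^ f * exp (2 * real f)"
    by (simp only: power_mult_distrib exp_of_nat_mult[symmetric] mult.commute)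
  finally have "(real (L + 1 + f) / real f) ^ f * exp (real f)
      \<le> (real L / real f) ^ f * exp (2 * real f) * exp (real f)"
    by (intro mult_right_mono) auto
  also have "\<dots> = (real L / real f) ^ f * exp (3 * real f)"
    by (simp add: mult.assoc flip: exp_add)
  finally show ?thesis
    using sum_choose_le_exp[of f "L + 1 + f"] assms by linarith
qed

text \<open>The number in parentheses exceeds \<open>log 2 z\<close>; four times as many bits hold
  \<open>z ^ 4\<close>. Since \<open>log 2 z \<ge> 1\<close>, the rounding at most doubles the
  bound.\<close>

lemma word_size:
  fixes z :: nat
  assumes "2 \<le> z"
  defines "w \<equiv> 4 * (nat \<lfloor>log 2 (real z)\<rfloor> + 1)"
  shows "z ^ 4 < 2 ^ w" "real w \<le> 8 / ln 2 * ln (real z)"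
proof -
  define b where "b = nat \<lfloor>log 2 (real z)\<rfloor> + 1"
  have log: "1 \<le> log 2 (real z)" using assms(1) by (simp add: le_log_iff)
  then have b: "log 2 (real z) < real b" "real b \<le> log 2 (real z) + 1"
    unfolding b_def by linarith+
  have "real z < 2 powr real b" using b(1) assms(1) by (simp add: log_less_iff)
  also have "\<dots> = real (2 ^ b)" by (simp add: powr_realpow)
  finally have "z < 2 ^ b" by (simp only: of_nat_less_iff)
  then have "z ^ 4 < (2 ^ b) ^ 4" by (intro power_strict_mono) auto
  also have "\<dots> = 2 ^ w" by (simp only: w_def b_def mult.commute flip: power_mult)
  finally show "z ^ 4 < 2 ^ w" .
  have "real w = 4 * real b" by (simp add: w_def b_def)
  then have "real w \<le> 8 * log 2 (real z)" using b(2) log by linarith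
  then show "real w \<le> 8 / ln 2 * ln (real z)" by (simp add: log_def)
qed

theorem theorem5:
  fixes f L :: "nat \<Rightarrow> nat" and k :: failure_kind
  assumes f_pos: "\<forall>n. f n \<ge> 1"
    and L_pos: "\<forall>n. L n \<ge> 1"
    and f_small: "(\<lambda>n. real (f n)) \<in> o(\<lambda>n. ln (real (L n)))"
  shows "\<exists>(P :: com) (w :: nat \<Rightarrow> nat) (cv :: nat \<Rightarrow> nat) (qt :: nat \<Rightarrow> nat) (sz :: nat \<Rightarrow> nat).
    (\<exists>\<epsilon> \<in> o(\<lambda>_. 1). cv \<in> soft_O (\<lambda>n. real (f n) * exp (real (f n)) *
        (real (L n) / real (f n)) powr (real (f n) + \<epsilon> n))) \<and>
    (\<exists>\<epsilon> \<in> o(\<lambda>_. 1). qt \<in> soft_O (\<lambda>n. real (f n) powr (5/2) * exp (real (f n)) *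
        (real (L n) / real (f n)) powr \<epsilon> n)) \<and>
    sz \<in> soft_O (\<lambda>n. real (f n) * exp (real (f n))) \<and>
    ((\<lambda>n. real (f n)) \<in> o(\<lambda>n. ln (real n)) \<longrightarrow>
        cv \<in> up_to_subpoly (\<lambda>n. (real (L n) / real (f n)) ^ f n) \<and>
        qt \<in> up_to_subpoly (\<lambda>_. 1) \<and>
        sz \<in> up_to_subpoly (\<lambda>_. 1)) \<and>
    (\<lambda>n. real (w n)) \<in> O(\<lambda>n. ln (real n + real (cv n))) \<and>
    (\<exists>c > 0. \<forall>n \<ge> 1. \<forall>G. wf_graph G \<and> verts G = {..<n} \<longrightarrow>
        (\<exists>D :: covering pmf. measure_pmf.prob D {C.
            is_covering k G (L n) (f n) C \<and>
            covering_value C \<le> cv n \<and>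
            query_time_le k G (f n) P (w n) C (qt n) \<and>
            selection_size_le k G (f n) C (sz n)} \<ge> 1 - real n powr (- c)))"
proof -
  \<comment> \<open>Rounding down and adding 1 gives the strict inequality required by
    \<open>failure_probability\<close>. All quantities depend only on \<open>n\<close>,
    \<open>f\<close> and \<open>L\<close>, so the graph enters a query only through the preprocessed
    memory.\<close>
  define R where "R = (\<lambda>n. nat \<lfloor>real (3 * f n + 2) * ln (real n) * exp (real (f n))\<rfloor> + 1)"
  define N where "N = (\<lambda>n. \<Sum>i\<le>f n. (L n + 1 + f n) choose i)"
  define cv where "cv = (\<lambda>n. R n * N n)"
  define qt where "qt = (\<lambda>n. R n * (10 * f n + 8) + 3)"
  define w where "w = (\<lambda>n. 4 * (nat \<lfloor>log 2 (real (n + cv n))\<rfloor> + 1))"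
  have f1: "1 \<le> real (f n)" for n using f_pos by simp
  have f_exp: "real (f n) \<le> exp (real (f n))" for n
    using exp_ge_add_one_self[of "real (f n)"] by linarith
  have R_le: "\<forall>\<^sub>F n in sequentially. 1 \<le> ln (real n) \<and>
      real (R n) \<le> 6 * (real (f n) * exp (real (f n)) * ln (real n))"
    using ln_of_nat_ge_one_eventually
  proof eventually_elim
    case (elim n)
    define E where "E = exp (real (f n)) * ln (real n)"
    have "1 * 1 \<le> E" unfolding E_def using elim by (intro mult_mono) auto
    then have E: "1 \<le> E" by simp
    have "real (R n) \<le> real (3 * f n + 2) * ln (real n) * exp (real (f n)) + 1"
      using elim unfolding R_def by simp
    also have "\<dots> = real (3 * f n + 2) * E + 1" by (simp add: E_def mult_ac)
    also have "\<dots> \<le> 5 * real (f n) * E + real (f n) * E"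
    proof (rule add_mono)
      show "real (3 * f n + 2) * E \<le> 5 * real (f n) * E"
        using f1[of n] E by (intro mult_right_mono) auto
      have "1 * 1 \<le> real (f n) * E" using f1[of n] E by (intro mult_mono) auto
      then show "1 \<le> real (f n) * E" by simp
    qed
    finally show ?case using elim by (simp add: E_def mult_ac)
  qed
  \<comment> \<open>One factor \<open>f\<close> comes from \<open>R\<close> and one from the query
    length; 126 is \<open>(10 + 8 + 3) * 6\<close>.\<close>
  have qt_le: "\<forall>\<^sub>F n in sequentially.
      real (qt n) \<le> 126 * (real (f n) powr 2 * exp (real (f n)) * ln (real n))"
    using R_le
  proof eventually_elim
    case (elim n)
    have R1: "1 \<le> real (R n)" by (simp add: R_def)
    have "1 * 1 \<le> real (R n) * real (f n)" using R1 f1[of n] by (intro mult_mono) auto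
    moreover have "real (R n) * 1 \<le> real (R n) * real (f n)" using R1 f1[of n] by (intro mult_left_mono) auto
    ultimately have "real (qt n) \<le> 21 * (real (R n) * real (f n))"
      unfolding qt_def by (simp add: algebra_simps)
    also have "\<dots> \<le> 21 * (6 * (real (f n) * exp (real (f n)) * ln (real n)) * real (f n))"
      using elim by (intro mult_left_mono mult_right_mono) auto
    finally show ?case using f1[of n] by (simp add: power2_eq_square mult_ac)
  qed
  obtain \<epsilon> where \<epsilon>: "\<epsilon> \<in> o(\<lambda>_. 1)" "\<forall>\<^sub>F n in sequentially.
      f n \<le> L n \<and> exp (3 * real (f n)) = (real (L n) / real (f n)) powr \<epsilon> n"
    using exp_absorbed[of f L 3] f_pos f_small by auto
  have cv_le: "\<forall>\<^sub>F n in sequentially. real (cv n) \<le>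
      6 * (real (f n) * exp (real (f n)) * ((real (L n) / real (f n)) ^ f n * exp (3 * real (f n))) * ln (real n))"
    using R_le \<epsilon>(2)
  proof eventually_elim
    case (elim n)
    have "real (N n) \<le> (real (L n) / real (f n)) ^ f n * exp (3 * real (f n))"
      unfolding N_def using elim f_pos by (intro sum_choose_bucket_sets_le) auto
    then have "real (R n) * real (N n) \<le> 6 * (real (f n) * exp (real (f n)) * ln (real n))
        * ((real (L n) / real (f n)) ^ f n * exp (3 * real (f n)))"
      using elim by (intro mult_mono) auto
    then show ?case by (simp add: cv_def mult_ac)
  qed

  \<comment> \<open>Verification of the asymptotic claims\<close>
  have "cv \<in> soft_O (\<lambda>n. real (f n) * exp (real (f n)) *
        (real (L n) / real (f n)) powr (real (f n) + \<epsilon> n))"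
  proof (rule soft_OI[of _ 6])
    show "\<forall>\<^sub>F n in sequentially. real (cv n) \<le> 6 * (real (f n) * exp (real (f n)) *
        (real (L n) / real (f n)) powr (real (f n) + \<epsilon> n) * ln (real n))"
      using cv_le \<epsilon>(2)
    proof eventually_elim
      case (elim n)
      have "0 < real (L n) / real (f n)" using f1[of n] L_pos[rule_format, of n] by simp
      then have "(real (L n) / real (f n)) powr (real (f n) + \<epsilon> n)
          = (real (L n) / real (f n)) ^ f n * exp (3 * real (f n))"
        using elim by (simp only: powr_add powr_realpow)
      then show ?case using elim by (simp only:)
    qed
  qed
  moreover have "qt \<in> soft_O (\<lambda>n. real (f n) powr (5/2) * exp (real (f n)) *
        (real (L n) / real (f n)) powr 0)"
  proof (rule soft_OI[of _ 126])
    show "\<forall>\<^sub>F n in sequentially. real (qt n) \<le> 126 * (real (f n) powr (5/2) * exp (real (f n)) *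
        (real (L n) / real (f n)) powr 0 * ln (real n))"
      using qt_le R_le
    proof eventually_elim
      case (elim n)
      have "real (f n) powr 2 \<le> real (f n) powr (5/2)"
        using f1[of n] by (intro powr_mono) auto
      then have "real (f n) powr 2 * exp (real (f n)) * ln (real n)
          \<le> real (f n) powr (5/2) * exp (real (f n)) * ln (real n)"
        using elim by (intro mult_right_mono) auto
      moreover have "(real (L n) / real (f n)) powr 0 = 1"
        using f1[of n] L_pos[rule_format, of n] by simp
      ultimately show ?case using elim(1) by (simp only: mult_1_right)
    qed
  qed
  moreover have "R \<in> soft_O (\<lambda>n. real (f n) * exp (real (f n)))"
    using R_le by (intro soft_OI[of _ 6]) (auto elim: eventually_mono)
  moreover have "cv \<in> up_to_subpoly (\<lambda>n. (real (L n) / real (f n)) ^ f n) \<and>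
        qt \<in> up_to_subpoly (\<lambda>_. 1) \<and> R \<in> up_to_subpoly (\<lambda>_. 1)"
    if small: "(\<lambda>n. real (f n)) \<in> o(\<lambda>n. ln (real n))"
  proof (intro conjI)
    show "cv \<in> up_to_subpoly (\<lambda>n. (real (L n) / real (f n)) ^ f n)"
    \<comment> \<open>The exponent 5 collects 1 from \<open>f \<le> exp f\<close>, 1 from
      \<open>R\<close> and 3 from the bucket sets.\<close>
    proof (rule up_to_subpolyI[OF small, of 6 _ _ 5])
      show "\<forall>\<^sub>F n in sequentially. real (cv n) \<le>
          (real (L n) / real (f n)) ^ f n * (6 * exp (5 * real (f n)) * ln (real n))"
        using cv_le R_le
      proof eventually_elim
        case (elim n)
        define A where "A = (real (L n) / real (f n)) ^ f n * exp (real (f n)) * exp (3 * real (f n)) * ln (real n)"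
        have "0 \<le> A" using elim by (simp add: A_def)
        have "real (cv n) \<le> 6 * (real (f n) * A)" using elim by (simp add: A_def mult_ac)
        also have "\<dots> \<le> 6 * (exp (real (f n)) * A)"
          using f_exp[of n] \<open>0 \<le> A\<close> by (intro mult_left_mono mult_right_mono) auto
        also have "\<dots> = (real (L n) / real (f n)) ^ f n *
            (6 * (exp (real (f n)) * exp (real (f n)) * exp (3 * real (f n))) * ln (real n))"
          by (simp add: A_def mult_ac)
        also have "exp (real (f n)) * exp (real (f n)) * exp (3 * real (f n)) = exp (5 * real (f n))"
          by (simp flip: exp_add)
        finally show ?case .
      qed
    qed simp
    show "qt \<in> up_to_subpoly (\<lambda>_. 1)"
    proof (rule up_to_subpolyI[OF small, of 126 _ _ 3])
      show "\<forall>\<^sub>F n in sequentially. real (qt n) \<le> 1 * (126 * exp (3 * real (f n)) * ln (real n))"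
        using qt_le R_le
      proof eventually_elim
        case (elim n)
        have "real (f n) powr 2 \<le> exp (real (f n)) powr 2"
          using f_exp[of n] by (intro powr_mono2) auto
        also have "\<dots> = exp (2 * real (f n))" by (simp add: exp_powr_real mult.commute)
        finally have "real (f n) powr 2 * exp (real (f n)) \<le> exp (2 * real (f n)) * exp (real (f n))"
          by (intro mult_right_mono) auto
        also have "\<dots> = exp (3 * real (f n))" by (simp flip: exp_add)
        finally have "real (f n) powr 2 * exp (real (f n)) * ln (real n) \<le> exp (3 * real (f n)) * ln (real n)"
          using elim by (intro mult_right_mono) auto
        then show ?case using elim by linarith
      qed
    qed simp
    show "R \<in> up_to_subpoly (\<lambda>_. 1)"
    proof (rule up_to_subpolyI[OF small, of 6 _ _ 2])
      show "\<forall>\<^sub>F n in sequentially. real (R n) \<le> 1 * (6 * exp (2 * real (f n)) * ln (real n))"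
        using R_le
      proof eventually_elim
        case (elim n)
        have "real (f n) * exp (real (f n)) \<le> exp (real (f n)) * exp (real (f n))"
          using f_exp[of n] by (intro mult_right_mono) auto
        also have "\<dots> = exp (2 * real (f n))" by (simp flip: exp_add)
        finally have "real (f n) * exp (real (f n)) * ln (real n) \<le> exp (2 * real (f n)) * ln (real n)"
          using elim by (intro mult_right_mono) auto
        then show ?case using elim by linarith
      qed
    qed simp
  qed
  moreover have "(\<lambda>n. real (w n)) \<in> O(\<lambda>n. ln (real n + real (cv n)))"
  proof (rule bigoI[of _ "8 / ln 2"])
    show "\<forall>\<^sub>F n in sequentially. norm (real (w n)) \<le> 8 / ln 2 * norm (ln (real n + real (cv n)))"
      using eventually_ge_at_top[of 2]
    proof eventually_elim
      case (elim n)
      then show ?case using word_size(2)[of "n + cv n"] by (simp add: w_def)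
    qed
  qed
  moreover have "\<exists>D :: covering pmf. measure_pmf.prob D {C.
            is_covering k G (L n) (f n) C \<and>
            covering_value C \<le> cv n \<and>
            query_time_le k G (f n) run_automata (w n) C (qt n) \<and>
            selection_size_le k G (f n) C (R n)} \<ge> 1 - real n powr (- 1)"
    if n: "1 \<le> n" and G: "wf_graph G" "verts G = {..<n}" for n G
  proof (cases "n = 1")
    \<comment> \<open>The required probability is \<open>1 - 1 = 0\<close>, so any distribution
      works.\<close>
    case True
    then show ?thesis by simp
  next
    case False
    then have n2: "2 \<le> n" using n by simp
    have "real (3 * f n + 2) * ln (real n) * exp (real (f n)) < real (R n)"
      unfolding R_def by linarith
    then have "(1 - exp (- real (f n))) ^ R n * real n ^ (3 * f n + 2) < 1"
      using failure_probability n by blast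
    moreover have "(n + cv n) ^ 4 < 2 ^ w n"
      unfolding w_def using n2 by (intro word_size(1)) simp
    ultimately obtain C where "is_covering k G (L n) (f n) C" "covering_value C \<le> cv n"
      "query_time_le k G (f n) run_automata (w n) C (qt n)" "selection_size_le k G (f n) C (R n)"
      using exists_covering[OF G n2, of "f n" "R n" "L n" "w n" k]
      unfolding cv_def N_def qt_def by blast
    then show ?thesis by (intro exI[of _ "return_pmf C"]) simp
  qed
  moreover have "(\<lambda>_. 0) \<in> o(\<lambda>_ :: nat. 1 :: real)" by simp
  ultimately show ?thesis
    using \<epsilon>(1)
    by (intro exI[of _ run_automata] exI[of _ w] exI[of _ cv] exI[of _ qt] exI[of _ R] conjI impI
        exI[of _ "1 :: real"] bexI[of _ \<epsilon>] bexI[of _ "\<lambda>_. 0"]) auto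
qed

end
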